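(* Let $T$ be an $n$-string link with a fixed abstract closure $\sigma$ to an oriented circle and a fixed point $\infty\in\partial T$, and let $m$ be the meridian of a positive quadruple crossing. The 1-cochain $$R_{F}(m)=\sum_{p\in m}\mathrm{sign}(p)\,W_1(p)\,\sigma_2\sigma_1(p)+\sum_{p\in m}\mathrm{sign}(p)\,W_2(p)\,(\sigma_2^2(p)-\sigma_1^2(p)),$$ with values in the Kauffman skein module of $\partial T$, is a solution of the positive global tetrahedron equation, i.e. $R_F(m)=0$ for every such $m$. Here the first sum is over all triple crossings $p$ in $m$ of global type $l_c$ or $r_a$, and the second sum is over all triple crossings $p$ in $m$ which have a distinguished crossing $d$ of type $0$ (global types $r_a,r_b,l_b$).
   Context: Setting. An $n$-string link $T$ consists of $n$ ordered, oriented, properly and smoothly embedded arcs in the cube $I^3=I^2\times I$, considered via the orthogonal projection $pr:I^3\to I^2$. Abstract arcs $\sigma$ are added (not embedded) so that $T\cup\sigma$ is one oriented circle; $\infty$ is a point of $\partial T$ on this circle. The Kauffman skein module of $\partial T$ is the module over $\mathbb{Z}[v^{\pm1},z^{\pm1}]$ of unoriented tangle diagrams with boundary $\partial T$ up to regular isotopy modulo: (crossing) $+$ (opposite crossing) $=z\,\cdot$ (sum of the two smoothings), a positive (negative) kink contributes $v$ ($v^{-1}$), and a trivial component contributes $(v+v^{-1})/z-1$. Crossings. Starting at $\infty$ and following the oriented circle, a crossing $q$ is of type $1$ if its under-cross is met before its over-cross, and of type $0$ otherwise. $w(q)=\pm1$ is the writhe of $q$. Triple crossings. At a triple crossing $p$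 the three branches are called low, mid, high according to height. The distinguished crossing $d$ is between low and high, $hm$ is between high and mid, $ml$ is between mid and low. The global type of $p$ is determined by the order in which the branches are met from $\infty$: $r_a$: mid, high, low; $r_b$: high, low, mid; $l_b$: high, mid, low; $l_c$: mid, low, high. When $d$ is of type $0$, an f-crossing of $p$ is a crossing $q\neq d$ of type $1$ whose under-cross lies on the oriented arc from $\infty$ to the over-cross of $d$. Weights. For a crossing $f$ of type $1$, an r-crossing for $f$ is a crossing $r$ such that, starting from $\infty$, one meets in this order: the under-cross of $f$, the over-cross of $r$, the over-cross of $f$, the under-cross of $r$. If $d$ is of type $0$, $W_2(p)=\sum w(f)w(r)$ over all pairs consisting of an f-crossing $f$ of $p$ and an r-crossing $r$ for $f$. If $p$ is of type $r_a$ or $l_c$ (then $hm$ is of type $1$), $W_1(p)=\sum w(r)$ over all r-crossings $r$ for $hm$. Crossings of the triangle ($d$, $hm$, $ml$) are included; all is computed in a small generic perturbation of $p$, and for positive triple crossings the result is the same for both perturbations. Positive triple crossings and smoothings. Braid words are read in the direction of the orientation, and positions are numbered so that in the positive crossing $\sigma_i$ the strand going from position $i$ to $i+1$ is the under strand. A triple crossing is positive if its three crossings are positive; then its perturbations are $\sigma_1\sigma_2\sigma_1$ and $\sigma_2\sigma_1\sigma_2$, and the Reidemeister move $\sigma_1\sigma_2\sigma_1\to\sigma_2\sigma_1\sigma_2$ has sign $+1$, its inverse sign $-1$. For a 3-braid $\beta$, $\beta(p)$ is the element of the skein module obtained by replacing the triple crossing by $\beta$. Quadruple crossings. A positive quadruple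 crossing is a point where four branches $1,2,3,4$ (from lowest to highest) meet in one point of the projection, pairwise transversally, forming a braid with all six crossings positive after perturbation. Its meridian $m$ is the loop of diagrams which is constant outside the quadruple crossing and which inside passes (up to far commutation) through the eight positive Reidemeister III moves given, with their signs, by $P_3:[121\to212]321\,(+)$, $P_4:21[232\to323]1\,(+)$, $\bar P_1:23[121\to212]3\,(+)$, $\bar P_2:[232\to323]123\,(+)$, $\bar P_3:321[323\to232]\,(-)$, $\bar P_4:3[212\to121]32\,(-)$, $P_1:1[323\to232]12\,(-)$, $P_2:123[212\to121]\,(-)$, where $i$ stands for $\sigma_i$. No assumption is made on the order in which the circle passes the four branches or on the position of $\infty$. *)

theory Defs
  imports Complex_Main "HOL-Library.Poly_Mapping" "HOL-Library.Product_Plus"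
begin

section \<open>Tangle diagrams\<close>

text \<open>
  A tangle diagram in the square, put in general position with respect to the height function, is
  written as the list of its elementary layers, read from top to bottom. The layer \<open>(i, g)\<close> is the
  generator \<open>g\<close> with \<open>i\<close> vertical strands to its left. \<open>Cap\<close> is a local maximum (it creates two
  strands), \<open>Cup\<close> is a local minimum. In \<open>Pos\<close> the strand from the upper left to the lower
  right is the under strand, in \<open>Neg\<close> it is the over strand; so \<open>Pos\<close> has writhe \<open>+1\<close> if both
  strands go down. Boundary points are placed on the top and bottom sides of the square.
\<close>

datatype gen = Cap | Cup | Pos | Neg

type_synonym diagram = "(nat \<times> gen) list"

fun ins :: "gen \<Rightarrow> nat" where
  "ins Cap = 0" | "ins Cup = 2" | "ins Pos = 2" | "ins Neg = 2"

fun outs :: "gen \<Rightarrow> nat" where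
  "outs Cap = 2" | "outs Cup = 0" | "outs Pos = 2" | "outs Neg = 2"

fun tangle :: "nat \<Rightarrow> diagram \<Rightarrow> nat \<Rightarrow> bool" where
  "tangle k [] l \<longleftrightarrow> k = l"
| "tangle k ((i, g) # D) l \<longleftrightarrow> i + ins g \<le> k \<and> tangle (k - ins g + outs g) D l"

fun width :: "nat \<Rightarrow> diagram \<Rightarrow> nat" where
  "width k [] = k"
| "width k ((i, g) # D) = width (k - ins g + outs g) D"

text \<open>
  Regular isotopy of unoriented diagrams, generated by local moves: the first seven rules are planar
  isotopy (change of relative heights of distant layers, cancellation of extrema, and passage of a
  crossing through an extremum of one of its strands), followed by Reidemeister II and III. Moves
  with the bigon or the triangle in another position or with other signs follow from these.
\<close>

inductive move :: "diagram \<Rightarrow> diagram \<Rightarrow> bool" where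
  exchange: "i + outs g \<le> j \<Longrightarrow> move [(i, g), (j, h)] [(j - outs g + ins g, h), (i, g)]"
| zigzag_left: "move [(i, Cap), (i + 1, Cup)] []"
| zigzag_right: "move [(i + 1, Cap), (i, Cup)] []"
| cap_pos: "move [(i, Cap), (i + 1, Pos)] [(i + 1, Cap), (i, Neg)]"
| cap_neg: "move [(i, Cap), (i + 1, Neg)] [(i + 1, Cap), (i, Pos)]"
| cup_pos: "move [(i + 1, Pos), (i, Cup)] [(i, Neg), (i + 1, Cup)]"
| cup_neg: "move [(i + 1, Neg), (i, Cup)] [(i, Pos), (i + 1, Cup)]"
| reidemeister2_pn: "move [(i, Pos), (i, Neg)] []"
| reidemeister2_np: "move [(i, Neg), (i, Pos)] []"
| reidemeister3: "move [(i, Pos), (i + 1, Pos), (i, Pos)] [(i + 1, Pos), (i, Pos), (i + 1, Pos)]"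


section \<open>The Kauffman skein module\<close>

text \<open>Laurent polynomials in \<open>v\<close> and \<open>z\<close>: the group ring of the group of exponent pairs.\<close>

type_synonym laurent = "(int \<times> int) \<Rightarrow>\<^sub>0 int"

definition v :: laurent where "v = Poly_Mapping.single (1, 0) 1"
definition v_inv :: laurent where "v_inv = Poly_Mapping.single (-1, 0) 1"
definition z :: laurent where "z = Poly_Mapping.single (0, 1) 1"
definition z_inv :: laurent where "z_inv = Poly_Mapping.single (0, -1) 1"

type_synonym lincomb = "diagram \<Rightarrow>\<^sub>0 laurent"

definition dia :: "diagram \<Rightarrow> lincomb" where
  "dia D = Poly_Mapping.single D 1"

definition smult :: "laurent \<Rightarrow> lincomb \<Rightarrow> lincomb" where
  "smult c = Poly_Mapping.map ((*) c)"

lemma lookup_smult: "Poly_Mapping.lookup (smult c x) D = c * Poly_Mapping.lookup x D"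
  by (simp add: smult_def Poly_Mapping.map.rep_eq when_def)

interpretation kauffman: module smult
  by unfold_locales (auto intro!: poly_mapping_eqI simp: lookup_smult lookup_add algebra_simps)

text \<open>
  In the rules for kinks the loop is to the right (left) of a vertical strand; the other forms of
  kinks are planar isotopic to these.
\<close>

inductive_set skein_relators :: "nat \<Rightarrow> nat \<Rightarrow> lincomb set" for k l where
  isotopy: "move M N \<Longrightarrow> tangle k (X @ M @ Y) l \<Longrightarrow> tangle k (X @ N @ Y) l \<Longrightarrow>
    dia (X @ M @ Y) - dia (X @ N @ Y) \<in> skein_relators k l"
| crossing: "tangle k (X @ [(i, Pos)] @ Y) l \<Longrightarrow>
    dia (X @ [(i, Pos)] @ Y) + dia (X @ [(i, Neg)] @ Y)
      - smult z (dia (X @ Y) + dia (X @ [(i, Cup), (i, Cap)] @ Y)) \<in> skein_relators k l"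
| positive_kink_right: "tangle k (X @ [(i + 1, Cap), (i, Pos), (i + 1, Cup)] @ Y) l \<Longrightarrow>
    dia (X @ [(i + 1, Cap), (i, Pos), (i + 1, Cup)] @ Y) - smult v (dia (X @ Y))
      \<in> skein_relators k l"
| positive_kink_left: "tangle k (X @ [(i, Cap), (i + 1, Pos), (i, Cup)] @ Y) l \<Longrightarrow>
    dia (X @ [(i, Cap), (i + 1, Pos), (i, Cup)] @ Y) - smult v (dia (X @ Y))
      \<in> skein_relators k l"
| negative_kink_right: "tangle k (X @ [(i + 1, Cap), (i, Neg), (i + 1, Cup)] @ Y) l \<Longrightarrow>
    dia (X @ [(i + 1, Cap), (i, Neg), (i + 1, Cup)] @ Y) - smult v_inv (dia (X @ Y))
      \<in> skein_relators k l"
| negative_kink_left: "tangle k (X @ [(i, Cap), (i + 1, Neg), (i, Cup)] @ Y) l \<Longrightarrow>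
    dia (X @ [(i, Cap), (i + 1, Neg), (i, Cup)] @ Y) - smult v_inv (dia (X @ Y))
      \<in> skein_relators k l"
| trivial_component: "tangle k (X @ [(i, Cap), (i, Cup)] @ Y) l \<Longrightarrow>
    dia (X @ [(i, Cap), (i, Cup)] @ Y) - smult ((v + v_inv) * z_inv - 1) (dia (X @ Y))
      \<in> skein_relators k l"

text \<open>
  The skein module of the boundary with \<open>k\<close> points on top and \<open>l\<close> points at the bottom is the quotient
  of the linear combinations of diagrams with this boundary by the span of the relators;
  \<open>skein_class k l x\<close> is the element (coset) represented by \<open>x\<close>.
\<close>

definition skein_class :: "nat \<Rightarrow> nat \<Rightarrow> lincomb \<Rightarrow> lincomb set" where
  "skein_class k l x = {y. y - x \<in> kauffman.span (skein_relators k l)}"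


section \<open>String links with an abstract closure\<close>

text \<open>
  A point \<open>(t, j)\<close> of a diagram is the \<open>j\<close>-th strand (from the left) between the layers \<open>t - 1\<close>
  and \<open>t\<close>. Points are \<open>joined\<close> if they are the two ends of a strand segment of one layer.
\<close>

type_synonym point = "nat \<times> nat"

definition points :: "nat \<Rightarrow> diagram \<Rightarrow> point set" where
  "points k D = {(t, j). t \<le> length D \<and> j < width k (take t D)}"

inductive segment :: "diagram \<Rightarrow> point \<Rightarrow> point \<Rightarrow> bool" for D where
  left: "t < length D \<Longrightarrow> D ! t = (i, g) \<Longrightarrow> j < i \<Longrightarrow> segment D (t, j) (t + 1, j)"
| right: "t < length D \<Longrightarrow> D ! t = (i, g) \<Longrightarrow> i + ins g \<le> j \<Longrightarrow>
    segment D (t, j) (t + 1, j - ins g + outs g)"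
| falling: "t < length D \<Longrightarrow> D ! t = (i, g) \<Longrightarrow> g \<in> {Pos, Neg} \<Longrightarrow> segment D (t, i) (t + 1, i + 1)"
| rising: "t < length D \<Longrightarrow> D ! t = (i, g) \<Longrightarrow> g \<in> {Pos, Neg} \<Longrightarrow> segment D (t, i + 1) (t + 1, i)"
| cap: "t < length D \<Longrightarrow> D ! t = (i, Cap) \<Longrightarrow> segment D (t + 1, i) (t + 1, i + 1)"
| cup: "t < length D \<Longrightarrow> D ! t = (i, Cup) \<Longrightarrow> segment D (t, i) (t, i + 1)"

definition joined :: "diagram \<Rightarrow> point \<Rightarrow> point \<Rightarrow> bool" where
  "joined D p q \<longleftrightarrow> segment D p q \<or> segment D q p"

datatype endpoint = Top nat | Bottom nat

fun location :: "diagram \<Rightarrow> endpoint \<Rightarrow> point" where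
  "location D (Top j) = (0, j)"
| "location D (Bottom j) = (length D, j)"

text \<open>
  The data at the boundary: the numbers of boundary points; for each of the ordered, oriented arcs
  its initial and its final point; the abstract closure, which joins the final point of arc \<open>i\<close> to
  the initial point of arc \<open>glue i\<close>; and the point at infinity.
\<close>

record closed_boundary =
  tops :: nat
  bottoms :: nat
  arcs :: "(endpoint \<times> endpoint) list"
  glue :: "nat \<Rightarrow> nat"
  infty :: endpoint

definition closes_up :: "closed_boundary \<Rightarrow> bool" where
  "closes_up B \<longleftrightarrow>
     (let n = length (arcs B); ends = map fst (arcs B) @ map snd (arcs B) in
        distinct ends \<and> set ends = Top ` {..<tops B} \<union> Bottom ` {..<bottoms B} \<and>
        bij_betw (glue B) {..<n} {..<n} \<and> (\<forall>i<n. \<forall>j<n. \<exists>m. (glue B ^^ m) i = j) \<and>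
        infty B \<in> set ends)"

definition arc_paths :: "closed_boundary \<Rightarrow> diagram \<Rightarrow> point list list \<Rightarrow> bool" where
  "arc_paths B D ps \<longleftrightarrow> length ps = length (arcs B) \<and>
     (\<forall>i<length ps. ps ! i \<noteq> [] \<and> successively (joined D) (ps ! i) \<and>
        hd (ps ! i) = location D (fst (arcs B ! i)) \<and>
        last (ps ! i) = location D (snd (arcs B ! i))) \<and>
     distinct (concat ps) \<and> set (concat ps) = points (tops B) D"

definition string_link :: "closed_boundary \<Rightarrow> diagram \<Rightarrow> bool" where
  "string_link B D \<longleftrightarrow>
     closes_up B \<and> tangle (tops B) D (bottoms B) \<and> (\<exists>ps. arc_paths B D ps)"

definition first_arc :: "closed_boundary \<Rightarrow> nat" where
  "first_arc B =
     (if infty B \<in> fst ` set (arcs B)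
      then THE i. i < length (arcs B) \<and> fst (arcs B ! i) = infty B
      else glue B (THE i. i < length (arcs B) \<and> snd (arcs B ! i) = infty B))"

text \<open>The points of the diagram in the order in which the oriented circle meets them from infinity.\<close>

definition route :: "closed_boundary \<Rightarrow> diagram \<Rightarrow> point list" where
  "route B D = (let ps = (THE ps. arc_paths B D ps) in
     concat (map (\<lambda>m. ps ! ((glue B ^^ m) (first_arc B))) [0..<length (arcs B)]))"

definition time :: "closed_boundary \<Rightarrow> diagram \<Rightarrow> point \<Rightarrow> nat" where
  "time B D p = (THE s. s < length (route B D) \<and> route B D ! s = p)"


section \<open>Crossings and weights\<close>

text \<open>A crossing is given by the number of its layer.\<close>

definition crossings :: "diagram \<Rightarrow> nat set" where
  "crossings D = {q. q < length D \<and> snd (D ! q) \<in> {Pos, Neg}}"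

definition falling_branch :: "diagram \<Rightarrow> nat \<Rightarrow> point \<times> point" where
  "falling_branch D q = ((q, fst (D ! q)), (q + 1, fst (D ! q) + 1))"

definition rising_branch :: "diagram \<Rightarrow> nat \<Rightarrow> point \<times> point" where
  "rising_branch D q = ((q, fst (D ! q) + 1), (q + 1, fst (D ! q)))"

definition under_branch :: "diagram \<Rightarrow> nat \<Rightarrow> point \<times> point" where
  "under_branch D q = (if snd (D ! q) = Pos then falling_branch D q else rising_branch D q)"

definition over_branch :: "diagram \<Rightarrow> nat \<Rightarrow> point \<times> point" where
  "over_branch D q = (if snd (D ! q) = Pos then rising_branch D q else falling_branch D q)"

definition goes_down :: "closed_boundary \<Rightarrow> diagram \<Rightarrow> point \<times> point \<Rightarrow> bool" where
  "goes_down B D b \<longleftrightarrow> time B D (fst b) < time B D (snd b)"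

definition passage :: "closed_boundary \<Rightarrow> diagram \<Rightarrow> point \<times> point \<Rightarrow> nat" where
  "passage B D b = min (time B D (fst b)) (time B D (snd b))"

definition under_time :: "closed_boundary \<Rightarrow> diagram \<Rightarrow> nat \<Rightarrow> nat" where
  "under_time B D q = passage B D (under_branch D q)"

definition over_time :: "closed_boundary \<Rightarrow> diagram \<Rightarrow> nat \<Rightarrow> nat" where
  "over_time B D q = passage B D (over_branch D q)"

definition writhe :: "closed_boundary \<Rightarrow> diagram \<Rightarrow> nat \<Rightarrow> int" where
  "writhe B D q =
     (if (snd (D ! q) = Pos) \<longleftrightarrow>
         (goes_down B D (under_branch D q) \<longleftrightarrow> goes_down B D (over_branch D q))
      then 1 else - 1)"

definition type1 :: "closed_boundary \<Rightarrow> diagram \<Rightarrow> nat \<Rightarrow> bool" where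
  "type1 B D q \<longleftrightarrow> under_time B D q < over_time B D q"

definition r_crossings :: "closed_boundary \<Rightarrow> diagram \<Rightarrow> nat \<Rightarrow> nat set" where
  "r_crossings B D f = {r \<in> crossings D.
     under_time B D f < over_time B D r \<and> over_time B D r < over_time B D f \<and>
     over_time B D f < under_time B D r}"

definition f_crossings :: "closed_boundary \<Rightarrow> diagram \<Rightarrow> nat \<Rightarrow> nat set" where
  "f_crossings B D d = {q \<in> crossings D.
     q \<noteq> d \<and> type1 B D q \<and> under_time B D q < over_time B D d}"


section \<open>Multiple crossings\<close>

text \<open>
  A place \<open>(X, j, Y)\<close> is a diagram with a hole between the layers \<open>X\<close> and the layers \<open>Y\<close>, with \<open>j\<close>
  strands to the left of the hole. Braids inserted into it are directed downwards (any parallel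
  direction of the branches can be rotated to this one by a planar isotopy of the whole diagram),
  and their positions are numbered \<open>1, 2, \<dots>\<close> from left to right, so that \<open>\<sigma>\<^sub>i\<close> is a \<open>Pos\<close> layer.
\<close>

type_synonym place = "diagram \<times> nat \<times> diagram"

definition braid :: "nat \<Rightarrow> nat list \<Rightarrow> diagram" where
  "braid j w = map (\<lambda>i. (j + i - 1, Pos)) w"

fun fill :: "place \<Rightarrow> nat list \<Rightarrow> diagram" where
  "fill (X, j, Y) w = X @ braid j w @ Y"

text \<open>
  The branches of a positive triple crossing enter the hole from left to right as low, mid, high.
  In \<open>\<sigma>\<^sub>1\<sigma>\<^sub>2\<sigma>\<^sub>1\<close> the crossings are \<open>ml\<close>, \<open>d\<close>, \<open>hm\<close> in this order, in \<open>\<sigma>\<^sub>2\<sigma>\<^sub>1\<sigma>\<^sub>2\<close> they are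
  \<open>hm\<close>, \<open>d\<close>, \<open>ml\<close>. In the sequel \<open>w\<close> is the perturbation, one of \<open>[1, 2, 1]\<close> and \<open>[2, 1, 2]\<close>.
\<close>

fun d_crossing :: "place \<Rightarrow> nat" where
  "d_crossing (X, j, Y) = length X + 1"

fun hm_crossing :: "place \<Rightarrow> nat list \<Rightarrow> nat" where
  "hm_crossing (X, j, Y) w = (if w = [1, 2, 1] then length X + 2 else length X)"

fun low_time :: "closed_boundary \<Rightarrow> place \<Rightarrow> nat list \<Rightarrow> nat" where
  "low_time B (X, j, Y) w = time B (fill (X, j, Y) w) (length X, j)"

fun mid_time :: "closed_boundary \<Rightarrow> place \<Rightarrow> nat list \<Rightarrow> nat" where
  "mid_time B (X, j, Y) w = time B (fill (X, j, Y) w) (length X, j + 1)"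

fun high_time :: "closed_boundary \<Rightarrow> place \<Rightarrow> nat list \<Rightarrow> nat" where
  "high_time B (X, j, Y) w = time B (fill (X, j, Y) w) (length X, j + 2)"

definition type_ra :: "closed_boundary \<Rightarrow> place \<Rightarrow> nat list \<Rightarrow> bool" where
  "type_ra B p w \<longleftrightarrow> mid_time B p w < high_time B p w \<and> high_time B p w < low_time B p w"

definition type_lc :: "closed_boundary \<Rightarrow> place \<Rightarrow> nat list \<Rightarrow> bool" where
  "type_lc B p w \<longleftrightarrow> mid_time B p w < low_time B p w \<and> low_time B p w < high_time B p w"

definition d_type0 :: "closed_boundary \<Rightarrow> place \<Rightarrow> nat list \<Rightarrow> bool" where
  "d_type0 B p w \<longleftrightarrow> \<not> type1 B (fill p w) (d_crossing p)"

definition W1 :: "closed_boundary \<Rightarrow> place \<Rightarrow> nat list \<Rightarrow> int" where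
  "W1 B p w = (let D = fill p w in
     \<Sum>r\<in>r_crossings B D (hm_crossing p w). writhe B D r)"

definition W2 :: "closed_boundary \<Rightarrow> place \<Rightarrow> nat list \<Rightarrow> int" where
  "W2 B p w = (let D = fill p w in
     \<Sum>f\<in>f_crossings B D (d_crossing p). \<Sum>r\<in>r_crossings B D f. writhe B D f * writhe B D r)"

text \<open>
  Inside the hole of a positive quadruple crossing the four branches form the half twist; they go
  down from the positions \<open>1, 2, 3, 4\<close> to the positions \<open>4, 3, 2, 1\<close>, and the branch entering at
  position \<open>i\<close> is the \<open>i\<close>-th one from below in the third dimension.
\<close>

fun positive_quadruple :: "closed_boundary \<Rightarrow> place \<Rightarrow> bool" where
  "positive_quadruple B (X, a, Y) \<longleftrightarrow>
     (let D = fill (X, a, Y) [1, 2, 1, 3, 2, 1] in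
        string_link B D \<and>
        (\<forall>i<4. time B D (length X, a + i) < time B D (length X + 6, a + 3 - i)))"

text \<open>
  The triple crossings of the meridian with their signs: the perturbation \<open>121\<close> or \<open>212\<close> of
  the triple crossing is preceded by a braid word \<open>x\<close> and followed by \<open>y\<close>, and it is shifted to the
  right by \<open>s\<close> strands.
\<close>

fun meridian :: "place \<Rightarrow> (int \<times> place) list" where
  "meridian (X, a, Y) =
     map (\<lambda>(e, x, s, y). (e, (X @ braid a x, a + s, braid a y @ Y)))
       [(1, [], 0, [3, 2, 1]),
        (1, [2, 1], 1, [1]),
        (1, [2, 3], 0, [3]),
        (1, [], 1, [1, 2, 3]),
        (- 1, [3, 2, 1], 1, []),
        (- 1, [3], 0, [3, 2]),
        (- 1, [1], 1, [1, 2]),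
        (- 1, [1, 2, 3], 0, [])]"

definition R_F :: "closed_boundary \<Rightarrow> (place \<Rightarrow> nat list) \<Rightarrow> place \<Rightarrow> lincomb set" where
  "R_F B pert Q = skein_class (tops B) (bottoms B)
     ((\<Sum>(e, p)\<leftarrow>meridian Q.
         if type_ra B p (pert p) \<or> type_lc B p (pert p)
         then smult (of_int (e * W1 B p (pert p))) (dia (fill p [2, 1])) else 0) +
      (\<Sum>(e, p)\<leftarrow>meridian Q.
         if d_type0 B p (pert p)
         then smult (of_int (e * W2 B p (pert p)))
           (dia (fill p [2, 2]) - dia (fill p [1, 1])) else 0))"

end

theory Submission
  imports Defs "HOL-Library.Multiset"
begin

text \<open>
  All words of the meridian are half twists of the same four branches. Identifying the points on the
  same branch at the same height changes no time: the branch \<open>b\<close> runs through the hole during the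
  times \<open>T b, \<dots>, T b + 6\<close>, and outside of the hole nothing changes. Hence the weights are sums of terms
  \<open>N i j\<close> and \<open>F j\<close>, which collect the crossings outside of the hole and depend only on the branches,
  and of numbers of crossings in the hole, which depend only on the order in which the branches are
  passed. Let \<open>x\<^sub>k\<close> and \<open>y\<^sub>k\<close> be the coefficients of the \<open>k\<close>-th entry of the meridian
  (\<open>k = 0, \<dots>, 7\<close>). For each of the 24 orders, and with \<open>N\<close> and \<open>F\<close> as formal variables,
  \<open>x\<^sub>0 + x\<^sub>1 = x\<^sub>4 + x\<^sub>5\<close>, \<open>x\<^sub>2 = x\<^sub>6 = y\<^sub>4 - y\<^sub>0\<close>, \<open>x\<^sub>3 = x\<^sub>7\<close>, \<open>y\<^sub>1 = y\<^sub>2 = y\<^sub>5 = y\<^sub>6\<close> and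
  \<open>y\<^sub>3 = y\<^sub>7\<close>. The remaining sum cancels by relations between positive braids; the skein relations
  for crossings and kinks are not used.
\<close>

section \<open>Uniqueness of the arcs\<close>

text \<open>A point \<open>(t, j)\<close> borders the layer \<open>t\<close> below it and the layer
  \<open>t - 1\<close> above it, and each of these continues its strand in one way.
  \<open>down_nb\<close> and \<open>up_nb\<close> compute the two continuations; their values are
  used only where the layer exists.\<close>

definition down_nb :: "diagram \<Rightarrow> point \<Rightarrow> point" where
  "down_nb D p = (case p of (t, j) \<Rightarrow> case D ! t of (i, g) \<Rightarrow>
     if j < i then (t + 1, j)
     else if i + ins g \<le> j then (t + 1, j - ins g + outs g)
     else (if g = Cup then t else t + 1, if j = i then i + 1 else i))"

definition up_nb :: "diagram \<Rightarrow> point \<Rightarrow> point" where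
  "up_nb D p = (case p of (t, j) \<Rightarrow> case D ! (t - 1) of (i, g) \<Rightarrow>
     if j < i then (t - 1, j)
     else if i + outs g \<le> j then (t - 1, j - outs g + ins g)
     else (if g = Cap then t else t - 1, if j = i then i + 1 else i))"

lemma joined_sym: "joined D p q \<longleftrightarrow> joined D q p"
  by (auto simp: joined_def)

lemma joined_neighbour:
  assumes "joined D p q"
  shows "(fst p < length D \<and> q = down_nb D p) \<or> (fst p > 0 \<and> q = up_nb D p)"
proof -
  have *: "((fst p < length D \<and> q = down_nb D p) \<or> (fst p > 0 \<and> q = up_nb D p)) \<and>
    ((fst q < length D \<and> p = down_nb D q) \<or> (fst q > 0 \<and> p = up_nb D q))"
    if "segment D p q" for p q
    using that by cases (auto simp: down_nb_def up_nb_def)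
  show ?thesis using assms *[of p q] *[of q p] unfolding joined_def by blast
qed

text \<open>Pigeonhole: every neighbour is one of the two candidates \<open>down_nb\<close> and
  \<open>up_nb\<close>.\<close>

lemma joined_three:
  assumes "joined D p q" "joined D p q'" "joined D p q''" "q \<noteq> q'" "q \<noteq> q''"
  shows "q' = q''"
  using assms by (metis joined_neighbour)

lemma joined_boundary:
  assumes "joined D p q" "joined D p q'" "fst p = 0 \<or> fst p = length D" "D \<noteq> []"
  shows "q = q'"
  using assms by (metis joined_neighbour less_irrefl)

text \<open>At a boundary point only one neighbour exists, so the first step is forced. Each later
  step must leave by the neighbour from which the path did not come.\<close>

lemma path_prefix:
  assumes "successively (joined D) xs" "distinct xs" "successively (joined D) ys" "distinct ys"
    and "xs \<noteq> []" "ys \<noteq> []" "hd xs = hd ys"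
    and b: "fst (hd xs) = 0 \<or> fst (hd xs) = length D" "D \<noteq> []"
    and "k < length xs" "k < length ys"
  shows "xs ! k = ys ! k"
  using assms(10,11)
proof (induction k rule: less_induct)
  case (less k)
  have jx: "joined D (xs ! i) (xs ! Suc i)" if "Suc i < length xs" for i
    using assms(1) that by (auto simp: successively_conv_nth)
  have jy: "joined D (ys ! i) (ys ! Suc i)" if "Suc i < length ys" for i
    using assms(3) that by (auto simp: successively_conv_nth)
  have h: "xs ! 0 = hd xs" "ys ! 0 = hd xs" using assms(5,6,7) by (auto simp: hd_conv_nth)
  consider "k = 0" | "k = Suc 0" | m where "k = Suc (Suc m)"
    by (metis not0_implies_Suc)
  then show ?case
  proof cases
    case 1 then show ?thesis using h by simp
  next
    case 2
    have "joined D (hd xs) (xs ! 1)" "joined D (hd xs) (ys ! 1)"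
      using jx[of 0] jy[of 0] h 2 less.prems by auto
    then show ?thesis using joined_boundary b 2 by fastforce
  next
    case 3
    have e: "xs ! m = ys ! m" "xs ! Suc m = ys ! Suc m"
      using less 3 by auto
    have "joined D (xs ! Suc m) (xs ! m)" "joined D (xs ! Suc m) (xs ! k)"
      "joined D (xs ! Suc m) (ys ! k)"
      using jx[of m] jx[of "Suc m"] jy[of "Suc m"] e 3 less.prems by (auto simp: joined_sym)
    moreover have "xs ! m \<noteq> xs ! k" "xs ! m \<noteq> ys ! k"
      using assms(2,4) less.prems 3 e by (auto simp: nth_eq_iff_index_eq)
    ultimately show ?thesis using joined_three by blast
  qed
qed

lemma path_unique:
  assumes "successively (joined D) xs" "distinct xs" "successively (joined D) ys" "distinct ys"
    and "xs \<noteq> []" "ys \<noteq> []" "hd xs = hd ys" "last xs = last ys"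
    and b: "fst (hd xs) = 0 \<or> fst (hd xs) = length D" "D \<noteq> []"
  shows "xs = ys"
proof -
  have pre: "xs ! k = ys ! k" if "k < length xs" "k < length ys" for k
    using path_prefix[OF assms(1-7) b that] .
  \<comment> \<open>If one path were a proper prefix of the other, the common last point would occur
    twice on the longer one.\<close>
  have aux: "length us = length vs"
    if "\<And>k. k < length us \<Longrightarrow> k < length vs \<Longrightarrow> us ! k = vs ! k"
      "last us = last vs" "distinct vs" "us \<noteq> []" "length us \<le> length vs" for us vs :: "point list"
  proof -
    have ne: "vs \<noteq> []" using that by auto
    have "vs ! (length us - 1) = vs ! (length vs - 1)"
      using that(1)[of "length us - 1"] that ne by (auto simp: last_conv_nth neq_Nil_conv)
    moreover have "length us - 1 < length vs" "length vs - 1 < length vs"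
      using that(4,5) ne by (cases us; auto)+
    ultimately have "length us - 1 = length vs - 1"
      using that(3) by (simp add: nth_eq_iff_index_eq)
    then show ?thesis using that(4) ne by (cases us; cases vs; auto)
  qed
  have "length xs = length ys"
    using aux[of xs ys] aux[of ys xs] pre assms by (metis nat_le_linear)
  then show ?thesis using pre by (simp add: list_eq_iff_nth_eq)
qed

lemma fst_location: "fst (location D e) = 0 \<or> fst (location D e) = length D"
  by (cases e) auto

lemma distinct_concat_nth:
  "distinct (concat ps) \<Longrightarrow> i < length ps \<Longrightarrow> distinct (ps ! i)"
  by (simp add: distinct_concat_iff)

text \<open>This gives a meaning to the definite description in \<open>route\<close>. The arcs begin
  on the top or bottom side, so \<open>path_unique\<close> applies to each of them.\<close>

lemma arc_paths_unique:
  assumes ps: "arc_paths B D ps" and qs: "arc_paths B D qs" and D: "D \<noteq> []"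
  shows "ps = qs"
proof (rule nth_equalityI)
  show "length ps = length qs" using ps qs by (simp add: arc_paths_def)
  fix i assume i: "i < length ps"
  then have i': "i < length qs" using ps qs by (simp add: arc_paths_def)
  have "distinct (ps ! i)" "distinct (qs ! i)"
    using ps qs i i' distinct_concat_nth unfolding arc_paths_def by blast+
  then show "ps ! i = qs ! i"
    by (intro path_unique[of D])
      (use ps qs D i i' fst_location in \<open>auto simp: arc_paths_def\<close>)
qed

lemma the_arc_paths:
  assumes "arc_paths B D ps" "D \<noteq> []"
  shows "(THE ps. arc_paths B D ps) = ps"
  using assms arc_paths_unique by blast

section \<open>The route\<close>

text \<open>A repetition among the first \<open>n\<close> iterates would confine the whole orbit to
  fewer than \<open>n\<close> values, but it has to reach all \<open>n\<close> indices.\<close>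

lemma orbit_covers:
  fixes g :: "nat \<Rightarrow> nat"
  assumes "i < n" "\<forall>j<n. \<exists>m. (g ^^ m) i = j" "\<And>j. j < n \<Longrightarrow> g j < n"
  shows "bij_betw (\<lambda>m. (g ^^ m) i) {..<n} {..<n}"
proof -
  let ?f = "\<lambda>m. (g ^^ m) i"
  have lt: "?f m < n" for m by (induction m) (use assms in auto)
  have "inj_on ?f {..<n}"
  proof (rule ccontr)
    assume "\<not> inj_on ?f {..<n}"
    then obtain a b where ab: "a < b" "b < n" "?f a = ?f b"
      by (auto simp: inj_on_def) (metis linorder_neqE_nat)
    have "\<exists>m'<b. ?f m = ?f m'" for m
    proof (induction m rule: less_induct)
      case (less m)
      show ?case
      proof (cases "m < b")
        case False
        have "?f m = (g ^^ (m - b)) (?f b)"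
          using False by (metis comp_apply funpow_add le_add_diff_inverse2 linorder_not_less)
        also have "\<dots> = ?f (m - b + a)" using ab(3) by (simp add: funpow_add)
        finally have "?f m = ?f (m - b + a)" .
        then show ?thesis using less[of "m - b + a"] ab False by auto
      qed auto
    qed
    then have "{..<n} \<subseteq> ?f ` {..<b}" using assms(2) by (metis (no_types, lifting) image_eqI lessThan_iff subsetI)
    then have "n \<le> card (?f ` {..<b})" using card_mono[of "?f ` {..<b}" "{..<n}"] by simp
    also have "\<dots> \<le> b" using card_image_le[of "{..<b}" ?f] by simp
    finally show False using ab by simp
  qed
  moreover have "?f ` {..<n} \<subseteq> {..<n}" using lt by auto
  ultimately show ?thesis
    by (simp add: bij_betw_def endo_inj_surj)
qed

lemma first_arc_less:
  assumes "closes_up B"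
  shows "first_arc B < length (arcs B)"
proof -
  let ?n = "length (arcs B)"
  have d: "distinct (map fst (arcs B))" "distinct (map snd (arcs B))"
    and inf: "infty B \<in> fst ` set (arcs B) \<union> snd ` set (arcs B)"
    and bij: "bij_betw (glue B) {..<?n} {..<?n}"
    using assms by (auto simp: closes_up_def Let_def)
  have the: "(THE i. i < ?n \<and> h (arcs B ! i) = infty B) < ?n"
    if dh: "distinct (map h (arcs B))" and ih: "infty B \<in> h ` set (arcs B)" for h :: "endpoint \<times> endpoint \<Rightarrow> endpoint"
  proof -
    obtain i where i: "i < ?n" "h (arcs B ! i) = infty B"
      using ih by (auto simp: in_set_conv_nth image_iff)
    moreover have "j = i" if "j < ?n \<and> h (arcs B ! j) = infty B" for j
      using nth_eq_iff_index_eq[OF dh, of i j] i that by simp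
    ultimately have "(THE i. i < ?n \<and> h (arcs B ! i) = infty B) = i" by blast
    then show ?thesis using i by simp
  qed
  show ?thesis
  proof (cases "infty B \<in> fst ` set (arcs B)")
    case True then show ?thesis using the[OF d(1)] by (simp add: first_arc_def)
  next
    case False
    then have "infty B \<in> snd ` set (arcs B)" using inf by blast
    then have "glue B (THE i. i < ?n \<and> snd (arcs B ! i) = infty B) \<in> {..<?n}"
      using bij_betwE[OF bij] the[OF d(2)] by blast
    then show ?thesis using False by (simp add: first_arc_def)
  qed
qed

lemma arc_order:
  assumes "closes_up B"
  shows "bij_betw (\<lambda>m. (glue B ^^ m) (first_arc B)) {..<length (arcs B)} {..<length (arcs B)}"
proof (rule orbit_covers)
  show "first_arc B < length (arcs B)" using assms by (rule first_arc_less)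
  then show "\<forall>j<length (arcs B). \<exists>m. (glue B ^^ m) (first_arc B) = j"
    using assms by (auto simp: closes_up_def Let_def)
  show "glue B j < length (arcs B)" if "j < length (arcs B)" for j
    using assms that bij_betwE[of "glue B" "{..<length (arcs B)}" "{..<length (arcs B)}"]
    by (auto simp: closes_up_def Let_def)
qed

text \<open>The route only permutes the arcs, so it has the same set of points and the same length
  as \<open>concat ps\<close>; distinctness follows by counting.\<close>

lemma concat_arc_order:
  assumes "closes_up B" "arc_paths B D ps"
  defines "r \<equiv> concat (map (\<lambda>m. ps ! ((glue B ^^ m) (first_arc B))) [0..<length (arcs B)])"
  shows "distinct r" "set r = points (tops B) D"
proof -
  let ?s = "\<lambda>m. (glue B ^^ m) (first_arc B)" let ?n = "length (arcs B)"
  have n: "length ps = ?n" and d: "distinct (concat ps)" and s: "set (concat ps) = points (tops B) D"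
    using assms(2) by (auto simp: arc_paths_def)
  have bij: "bij_betw ?s {..<?n} {..<?n}" by (rule arc_order[OF assms(1)])
  have im: "?s ` {..<?n} = {..<?n}" using bij by (simp add: bij_betw_def)
  have "set r = (\<Union>i\<in>?s ` {..<?n}. set (ps ! i))" by (auto simp: r_def)
  also have "\<dots> = set (concat ps)"
  proof -
    have "set ps = (!) ps ` {..<?n}" using n by (force simp: in_set_conv_nth)
    then show ?thesis unfolding im by auto
  qed
  finally have sr: "set r = set (concat ps)" .
  then show "set r = points (tops B) D" using s by simp
  have "length r = (\<Sum>m<?n. length (ps ! ?s m))"
    by (simp add: r_def length_concat comp_def sum_list_sum_nth atLeast0LessThan)
  also have "\<dots> = (\<Sum>i<?n. length (ps ! i))" using sum.reindex_bij_betw[OF bij] by simp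
  also have "\<dots> = length (concat ps)"
    by (simp add: length_concat sum_list_sum_nth atLeast0LessThan n)
  finally have "card (set r) = length r" using sr distinct_card[OF d] by simp
  then show "distinct r" by (rule card_distinct)
qed

lemma route_of_paths:
  assumes "arc_paths B D ps" "D \<noteq> []"
  shows "route B D = concat (map (\<lambda>m. ps ! ((glue B ^^ m) (first_arc B))) [0..<length (arcs B)])"
  using assms by (simp add: route_def the_arc_paths)

lemma route_distinct:
  assumes "string_link B D" "D \<noteq> []"
  shows "distinct (route B D)" and "set (route B D) = points (tops B) D"
  using assms concat_arc_order route_of_paths unfolding string_link_def by metis+

lemma time_nth:
  assumes "distinct (route B D)" "s < length (route B D)"
  shows "time B D (route B D ! s) = s"
  unfolding time_def by (rule the_equality) (use assms in \<open>auto simp: nth_eq_iff_index_eq\<close>)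

lemma time_inject:
  assumes "string_link B D" "D \<noteq> []" "p \<in> points (tops B) D" "q \<in> points (tops B) D"
    and "time B D p = time B D q"
  shows "p = q"
  using assms route_distinct[OF assms(1,2)] time_nth by (metis in_set_conv_nth)

text \<open>Cuts out of the route the arc through \<open>p\<close>. The offset \<open>c\<close> is
  the number of points of the route before this arc.\<close>

lemma points_in_arc:
  assumes "string_link B D" "D \<noteq> []" "p \<in> points (tops B) D"
  obtains c xs where "successively (joined D) xs" "xs \<noteq> []"
    "fst (hd xs) \<in> {0, length D}" "fst (last xs) \<in> {0, length D}" "p \<in> set xs" "distinct xs"
    "\<And>k. k < length xs \<Longrightarrow> time B D (xs ! k) = c + k"
proof -
  obtain ps where ps: "arc_paths B D ps" and cl: "closes_up B"
    using assms(1) by (auto simp: string_link_def)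
  let ?s = "\<lambda>m. (glue B ^^ m) (first_arc B)" let ?n = "length (arcs B)"
  have n: "length ps = ?n" using ps by (simp add: arc_paths_def)
  have r: "route B D = concat (map (\<lambda>m. ps ! ?s m) [0..<?n])"
    using route_of_paths[OF ps assms(2)] .
  have "p \<in> set (route B D)" using route_distinct[OF assms(1,2)] assms(3) by simp
  then obtain m where m: "m < ?n" "p \<in> set (ps ! ?s m)" unfolding r by auto
  let ?xs = "ps ! ?s m"
  have sm: "?s m < length ps" using arc_order[OF cl] m(1) n bij_betwE by fastforce
  have "[0..<?n] = [0..<m] @ m # [Suc m..<?n]"
    using m(1) upt_add_eq_append[of 0 m "?n - m"] by (simp add: upt_conv_Cons)
  then obtain A C where AC: "route B D = A @ ?xs @ C" unfolding r by simp
  have d: "distinct (A @ ?xs @ C)" using route_distinct(1)[OF assms(1,2)] AC by simp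
  have "time B D (?xs ! k) = length A + k" if "k < length ?xs" for k
    using time_nth[OF route_distinct(1)[OF assms(1,2)], of "length A + k"] that
    by (simp add: AC nth_append)
  moreover have "?xs \<noteq> [] \<and> successively (joined D) ?xs \<and> hd ?xs = location D (fst (arcs B ! ?s m))
    \<and> last ?xs = location D (snd (arcs B ! ?s m))"
    using ps sm by (simp add: arc_paths_def)
  ultimately show ?thesis
    using m(2) d fst_location[of D] by (intro that[of ?xs "length A"]) auto
qed

text \<open>Arcs end only on the boundary, so \<open>p\<close> has a predecessor and a successor on
  its arc. By \<open>joined_three\<close> these are all its neighbours.\<close>

lemma time_joined:
  assumes "string_link B D" "p \<in> points (tops B) D" "joined D p q" "0 < fst p" "fst p < length D"
  shows "time B D q = Suc (time B D p) \<or> time B D p = Suc (time B D q)"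
proof -
  have "D \<noteq> []" using assms(5) by auto
  from points_in_arc[OF assms(1) this assms(2)] obtain c xs where
    xs: "successively (joined D) xs" "xs \<noteq> []" "fst (hd xs) \<in> {0, length D}"
    "fst (last xs) \<in> {0, length D}" "p \<in> set xs" "distinct xs"
    "\<And>k. k < length xs \<Longrightarrow> time B D (xs ! k) = c + k"
    by metis
  obtain k where k: "k < length xs" "p = xs ! k" using xs(5) by (auto simp: in_set_conv_nth)
  have "k \<noteq> 0" using xs(2,3) k assms(4,5) by (intro notI) (auto simp: hd_conv_nth)
  moreover have "k \<noteq> length xs - 1" using xs(2,4) k assms(4,5) by (intro notI) (auto simp: last_conv_nth)
  ultimately obtain l where l: "k = Suc l" "Suc (Suc l) < length xs"
    using k(1) by (cases k) auto
  have j: "joined D p (xs ! l)" "joined D p (xs ! Suc (Suc l))"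
    using xs(1) l k joined_sym by (auto simp: successively_conv_nth)
  have "xs ! l \<noteq> xs ! Suc (Suc l)" using xs(6) l by (simp add: nth_eq_iff_index_eq)
  then have "q = xs ! l \<or> q = xs ! Suc (Suc l)" using joined_three j assms(3) by blast
  then show ?thesis using xs(7)[of l] xs(7)[of k] xs(7)[of "Suc k"] l k by auto
qed

section \<open>Relabelling the points\<close>

text \<open>Such a map carries the arcs of \<open>D\<close> to arcs of \<open>D'\<close> with the
  same ends. Uniqueness of the arcs then identifies the two routes, and all times agree.\<close>

locale relabelling =
  fixes B :: closed_boundary and D D' :: diagram and \<phi> :: "point \<Rightarrow> point"
  assumes inj: "inj \<phi>"
    and segments: "\<And>p q. segment D p q \<Longrightarrow> segment D' (\<phi> p) (\<phi> q)"
    and points: "\<phi> ` points (tops B) D = points (tops B) D'"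
    and length: "length D' = length D"
    and boundary: "\<And>j. \<phi> (0, j) = (0, j)" "\<And>j. \<phi> (length D, j) = (length D, j)"
    and nonempty: "D \<noteq> []"
begin

lemma arc_paths:
  assumes "arc_paths B D ps"
  shows "arc_paths B D' (map (map \<phi>) ps)"
proof -
  have loc: "location D' e = \<phi> (location D e)" for e
    by (cases e) (simp_all add: boundary length)
  have jo: "joined D' (\<phi> p) (\<phi> q)" if "joined D p q" for p q
    using that segments unfolding joined_def by blast
  have "distinct (concat (map (map \<phi>) ps))"
    using assms inj by (simp add: arc_paths_def map_concat[symmetric] distinct_map inj_on_subset[OF inj])
  moreover have "set (concat (map (map \<phi>) ps)) = points (tops B) D'"
    using assms by (simp only: map_concat[symmetric] set_map arc_paths_def points)
  moreover have "successively (joined D') (map \<phi> xs)" if "successively (joined D) xs" for xs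
    using that jo by (auto simp: successively_conv_nth)
  ultimately show ?thesis using assms by (auto simp: arc_paths_def hd_map last_map loc)
qed

lemma route:
  assumes "string_link B D"
  shows "route B D' = map \<phi> (route B D)"
proof -
  obtain ps where ps: "Defs.arc_paths B D ps" and cl: "closes_up B"
    using assms by (auto simp: string_link_def)
  have "D' \<noteq> []" using nonempty length by auto
  have s: "(glue B ^^ m) (first_arc B) < length ps" if "m < length (arcs B)" for m
    using arc_order[OF cl] that ps bij_betwE by (fastforce simp: arc_paths_def)
  show ?thesis
    unfolding route_of_paths[OF ps nonempty] route_of_paths[OF arc_paths[OF ps] \<open>D' \<noteq> []\<close>]
    by (auto simp: map_concat s intro!: arg_cong[of _ _ concat])
qed

lemma time:
  assumes "string_link B D"
  shows "time B D' (\<phi> p) = time B D p"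
proof -
  have "(s < List.length (route B D') \<and> route B D' ! s = \<phi> p) \<longleftrightarrow>
    (s < List.length (route B D) \<and> route B D ! s = p)" for s
    using inj by (auto simp: route[OF assms] inj_eq)
  then show ?thesis by (simp add: time_def)
qed

end

section \<open>Braids in a hole\<close>

definition flip :: "nat \<Rightarrow> nat \<Rightarrow> nat" where
  "flip i j = (if j = i then i + 1 else if j = i + 1 then i else j)"

text \<open>The strand that enters a braid at position \<open>j\<close>, where the hole begins at \<open>a\<close>, leaves it at
  position \<open>carry a w j\<close>; here the positions are counted from \<open>0\<close>.\<close>

definition carry :: "nat \<Rightarrow> nat list \<Rightarrow> nat \<Rightarrow> nat" where
  "carry a w = fold (\<lambda>i. flip (a + i - 1)) w"

lemma flip_flip [simp]: "flip i (flip i j) = j"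
  by (auto simp: flip_def)

lemma carry_Nil [simp]: "carry a [] j = j"
  by (simp add: carry_def)

lemma carry_Cons: "carry a (i # w) j = carry a w (flip (a + i - 1) j)"
  by (simp add: carry_def)

lemma carry_append: "carry a (w @ w') j = carry a w' (carry a w j)"
  by (simp add: carry_def)

lemma carry_rev [simp]: "carry a w (carry a (rev w) j) = j"
  by (induction w arbitrary: j rule: rev_induct) (simp_all add: carry_append carry_Cons)

lemma carry_rev' [simp]: "carry a (rev w) (carry a w j) = j"
  using carry_rev[of a "rev w"] by simp

text \<open>Letters count from 1, so the truncated subtraction in \<open>a + i - 1\<close> commutes
  with the shift by \<open>a\<close>.\<close>

lemma carry_shift:
  assumes "\<forall>i\<in>set w. 1 \<le> i"
  shows "carry a w (a + b) = a + carry 0 w b"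
  using assms
proof (induction w arbitrary: b)
  case (Cons i w)
  then have "flip (a + i - 1) (a + b) = a + flip (i - 1) b" by (auto simp: flip_def)
  then show ?case using Cons by (simp add: carry_Cons)
qed simp

lemma carry_less:
  assumes "\<forall>i\<in>set w. 1 \<le> i \<and> a + i < k"
  shows "carry a w j < k \<longleftrightarrow> j < k"
  using assms by (induction w arbitrary: j) (auto simp: carry_Cons flip_def)

lemma carry_outside:
  assumes "\<forall>i\<in>set w. 1 \<le> i \<and> i \<le> 3" "j < a \<or> a + 4 \<le> j"
  shows "carry a w j = j"
  using assms by (induction w arbitrary: j) (auto simp: carry_Cons flip_def)

section \<open>Widths and segments of braid layers\<close>

lemma width_append: "width k (D @ E) = width (width k D) E"
  by (induction k D rule: width.induct) auto

lemma tangle_append: "tangle k (D @ E) l \<longleftrightarrow> tangle k D (width k D) \<and> tangle (width k D) E l"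
  by (induction k D "width k D" rule: tangle.induct) auto

lemma length_braid [simp]: "length (braid j w) = length w"
  by (simp add: braid_def)

lemma width_braid:
  assumes "2 \<le> k"
  shows "width k (braid j w) = k"
proof -
  have "Suc (Suc (k - 2)) = k" using assms by simp
  then show ?thesis by (induction w) (auto simp: braid_def)
qed

lemma tangle_braid_bound:
  assumes "tangle k (braid j w) l" "i \<in> set w" "2 \<le> k"
  shows "j + i + 1 \<le> k"
proof -
  have "Suc (Suc (k - 2)) = k" using assms by simp
  then show ?thesis using assms(1,2) by (induction w) (auto simp: braid_def)
qed

text \<open>A segment depends on a single layer \<open>t\<close>. It can therefore be transferred to
  any diagram with the same layer there, and at a positive crossing it is given by
  \<open>flip\<close>.\<close>

lemma segment_layer:
  assumes "segment D p q"
  obtains t where "t < length D" "fst p \<in> {t, t + 1}" "fst q \<in> {t, t + 1}"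
    "\<And>D'. t < length D' \<Longrightarrow> D' ! t = D ! t \<Longrightarrow> segment D' p q"
    "snd (D ! t) = Pos \<Longrightarrow> fst p = t \<and> q = (t + 1, flip (fst (D ! t)) (snd p))"
  using assms by cases (fastforce simp: flip_def intro: segment.intros)+

lemma segment_crossing:
  assumes "t < length D" "D ! t = (i, Pos)"
  shows "segment D (t, j) (t + 1, flip i j)"
proof -
  consider "j < i" | "j = i" | "j = i + 1" | "i + 2 \<le> j" by linarith
  then show ?thesis
  proof cases
    case 4
    then have "Suc (Suc (j - 2)) = j" "flip i j = j" by (auto simp: flip_def)
    then show ?thesis using segment.right[OF assms, of j] 4 by simp
  qed (use segment.left[OF assms] segment.falling[OF assms] segment.rising[OF assms] in \<open>auto simp: flip_def\<close>)
qed

text \<open>These are the reduced words of the longest permutation of four strands, with positions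
  counted from 0.\<close>

definition half_twist :: "nat list \<Rightarrow> bool" where
  "half_twist u \<longleftrightarrow> length u = 6 \<and> set u \<subseteq> {1, 2, 3} \<and> (\<forall>b<4. carry 0 u b = 3 - b)"

lemma half_twist_carry:
  assumes "half_twist u" "half_twist u'"
  shows "carry a u j = carry a u' j"
proof (cases "j < a \<or> a + 4 \<le> j")
  case True
  moreover have "\<forall>i\<in>set u. 1 \<le> i \<and> i \<le> 3" "\<forall>i\<in>set u'. 1 \<le> i \<and> i \<le> 3"
    using assms by (auto simp: half_twist_def)
  ultimately show ?thesis using carry_outside by metis
next
  case False
  then obtain b where b: "j = a + b" "b < 4" by (metis add_less_cancel_left le_Suc_ex not_less)
  have "\<forall>i\<in>set u. 1 \<le> i" "\<forall>i\<in>set u'. 1 \<le> i" using assms by (auto simp: half_twist_def)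
  then show ?thesis using b assms by (simp add: carry_shift half_twist_def)
qed

text \<open>The word used in \<open>positive_quadruple\<close>; all other fillings of the hole are
  compared with it.\<close>

definition w0 :: "nat list" where "w0 = [1, 2, 1, 3, 2, 1]"

lemma half_twist_w0: "half_twist w0"
  by code_simp

text \<open>A sequence with steps of size one that never turns back keeps its direction, and
  \<open>f 0 < f m\<close> excludes the descending one.\<close>

lemma monotone_steps:
  fixes f :: "nat \<Rightarrow> nat"
  assumes "\<And>s. s < m \<Longrightarrow> f (Suc s) = Suc (f s) \<or> f s = Suc (f (Suc s))"
    and "\<And>s. Suc s < m \<Longrightarrow> f s \<noteq> f (Suc (Suc s))" and "f 0 < f m" "s \<le> m"
  shows "f s = f 0 + s"
proof -
  have up: "f s = f 0 + s" if "f 1 = Suc (f 0)" "s \<le> m" for s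
  proof -
    have step: "f (Suc k) = Suc (f k)" if "k < m" for k
      using that
    proof (induct k)
      case (Suc k)
      then show ?case using assms(1)[of "Suc k"] assms(2)[of k] by simp
    qed (use \<open>f 1 = Suc (f 0)\<close> in simp)
    show ?thesis using \<open>s \<le> m\<close>
    proof (induct s)
      case (Suc s)
      then show ?case using step[of s] by simp
    qed simp
  qed
  have down: "f s + s = f 0" if "f 0 = Suc (f 1)" "s \<le> m" for s
  proof -
    have step: "f k = Suc (f (Suc k))" if "k < m" for k
      using that
    proof (induct k)
      case (Suc k)
      then show ?case using assms(1)[of "Suc k"] assms(2)[of k] by simp
    qed (use \<open>f 0 = Suc (f 1)\<close> in simp)
    show ?thesis using \<open>s \<le> m\<close>
    proof (induct s)
      case (Suc s)
      then show ?case using step[of s] by simp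
    qed simp
  qed
  have "0 < m" using assms(3) by (cases m) auto
  then have "f 1 = Suc (f 0) \<or> f 0 = Suc (f 1)" using assms(1)[of 0] by simp
  then show ?thesis
  proof
    assume "f 1 = Suc (f 0)"
    then show ?thesis using up assms(4) by blast
  next
    assume "f 0 = Suc (f 1)"
    then have "f m + m = f 0" using down by blast
    then show ?thesis using assms(3) by linarith
  qed
qed

section \<open>Times in the hole of a quadruple crossing\<close>

locale quadruple =
  fixes B :: closed_boundary and X :: diagram and a :: nat and Y :: diagram
  assumes positive: "positive_quadruple B (X, a, Y)"
begin

abbreviation dgm :: "nat list \<Rightarrow> diagram" where "dgm u \<equiv> fill (X, a, Y) u"
abbreviation n :: nat where "n \<equiv> length X"

definition T :: "nat \<Rightarrow> nat" where "T b = time B (dgm w0) (n, a + b)"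

definition pt :: "nat list \<Rightarrow> nat \<Rightarrow> nat \<Rightarrow> point" where
  "pt u s b = (n + s, a + carry 0 (take s u) b)"

text \<open>A point in the hole is traced back along \<open>w0\<close> to the top of the hole and
  then followed down along \<open>u\<close> to its old height.\<close>

definition relabel :: "nat list \<Rightarrow> point \<Rightarrow> point" where
  "relabel u p = (case p of (t, j) \<Rightarrow> if n \<le> t \<and> t \<le> n + 6
     then (t, carry a (take (t - n) u) (carry a (rev (take (t - n) w0)) j)) else p)"

lemma string_link_w0: "string_link B (dgm w0)"
  using positive by (simp add: Let_def w0_def)

lemma length_dgm: "half_twist u \<Longrightarrow> length (dgm u) = n + 6 + length Y"
  by (simp add: half_twist_def)

lemma dgm_before: "t < n \<Longrightarrow> dgm u ! t = X ! t"
  by (simp add: nth_append)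

lemma dgm_inside: "half_twist u \<Longrightarrow> s < 6 \<Longrightarrow> dgm u ! (n + s) = (a + u ! s - 1, Pos)"
  by (simp add: nth_append half_twist_def braid_def)

lemma dgm_after: "half_twist u \<Longrightarrow> dgm u ! (n + 6 + t) = Y ! t"
  by (simp add: nth_append half_twist_def)

lemma width_X: "a + 4 \<le> width (tops B) X"
proof -
  let ?k = "width (tops B) X"
  have t: "tangle ?k (braid a w0) (width ?k (braid a w0))"
    using string_link_w0 by (simp add: string_link_def tangle_append)
  then have "2 \<le> ?k" by (auto simp: braid_def w0_def)
  \<comment> \<open>The letter 3 of \<open>w0\<close> crosses the strands \<open>a + 2\<close> and
    \<open>a + 3\<close>.\<close>
  then show ?thesis using tangle_braid_bound[OF t, of 3] by (simp add: w0_def)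
qed

lemma width_dgm:
  assumes "half_twist u"
  shows "width (tops B) (take t (dgm u)) =
    (if t < n then width (tops B) (take t X)
     else if t \<le> n + 6 then width (tops B) X
     else width (width (tops B) X) (take (t - n - 6) Y))"
proof -
  have "take t (braid a u) = braid a (take t u)" for t by (simp add: braid_def take_map)
  moreover have "braid a [] = []" by (simp add: braid_def)
  ultimately show ?thesis
    using assms width_X by (auto simp: width_append width_braid half_twist_def)
qed

lemma points_dgm:
  assumes "half_twist u" "s \<le> 6" "b < 4"
  shows "pt u s b \<in> points (tops B) (dgm u)"
proof -
  have "set u \<subseteq> {1, 2, 3}" using assms by (simp add: half_twist_def)
  then have "\<forall>i\<in>set (take s u). 1 \<le> i \<and> 0 + i < 4" using set_take_subset[of s u] by fastforce
  then have "carry 0 (take s u) b < 4" using carry_less assms(3) by blast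
  then show ?thesis
    using assms width_X by (auto simp: pt_def points_def length_dgm width_dgm simp del: fill.simps)
qed

text \<open>At the lower end of the hole both half twists induce the same permutation, so
  \<open>relabel\<close> agrees there with the identity below.\<close>

lemma relabel_fixed:
  assumes "half_twist u" "t \<le> n \<or> n + 6 \<le> t"
  shows "relabel u (t, j) = (t, j)"
proof (cases "t = n + 6")
  case True
  have "length u = 6" "length w0 = 6" using assms half_twist_w0 by (auto simp: half_twist_def)
  then show ?thesis
    using True half_twist_carry[OF assms(1) half_twist_w0] carry_rev[of a w0 j]
    by (simp add: relabel_def)
next
  case False
  then show ?thesis using assms by (auto simp: relabel_def)
qed

lemma relabel_inverse:
  "relabel u (t, carry a (take (t - n) w0) (carry a (rev (take (t - n) u)) j)) = (t, j)" if "n \<le> t" "t \<le> n + 6"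
  using that by (simp add: relabel_def)

lemma relabel_segment:
  assumes u: "half_twist u" and "segment (dgm w0) p q"
  shows "segment (dgm u) (relabel u p) (relabel u q)"
  using assms(2)
proof (rule segment_layer)
  fix t
  assume t: "t < length (dgm w0)" "fst p \<in> {t, t + 1}" "fst q \<in> {t, t + 1}"
    and same: "\<And>D'. t < length D' \<Longrightarrow> D' ! t = dgm w0 ! t \<Longrightarrow> segment D' p q"
    and pos: "snd (dgm w0 ! t) = Pos \<Longrightarrow> fst p = t \<and> q = (t + 1, flip (fst (dgm w0 ! t)) (snd p))"
  have tu: "t < length (dgm u)" using t(1) length_dgm[OF u] length_dgm[OF half_twist_w0] by simp
  obtain pt pj qt qj where pq: "p = (pt, pj)" "q = (qt, qj)" by fastforce
  consider "t < n" | "n + 6 \<le> t" | s where "t = n + s" "s < 6"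
    by (metis le_add_diff_inverse linorder_not_less nat_add_left_cancel_less)
  then show ?thesis
  proof cases
    case 1
    then have "relabel u p = p" "relabel u q = q" using t pq relabel_fixed[OF u] by auto
    then show ?thesis using same[OF tu] 1 dgm_before by simp
  next
    case 2
    then have "relabel u p = p" "relabel u q = q" using t pq relabel_fixed[OF u] by auto
    moreover obtain y where "t = n + 6 + y" using 2 by (metis le_Suc_ex)
    then have "dgm u ! t = dgm w0 ! t" using dgm_after[OF u] dgm_after[OF half_twist_w0] by simp
    ultimately show ?thesis using same[OF tu] by simp
  next
    case 3
    \<comment> \<open>\<open>j\<close> is the position at which the strand through \<open>p\<close>
      enters the hole. In both words the layer \<open>s\<close> applies one more letter to
      it.\<close>
    define j where "j = carry a (rev (take s w0)) pj"
    have p: "p = (t, carry a (take s w0) j)" using pos 3 pq dgm_inside[OF half_twist_w0]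
      by (simp add: j_def del: fill.simps)
    have sl: "s < length w0" "s < length u" using 3 u half_twist_w0 by (auto simp: half_twist_def)
    have "q = (t + 1, flip (a + w0 ! s - 1) (carry a (take s w0) j))"
      using pos 3 p dgm_inside[OF half_twist_w0, of s] by (simp del: fill.simps)
    also have "\<dots> = (t + 1, carry a (take (Suc s) w0) j)"
      unfolding take_Suc_conv_app_nth[OF sl(1)] by (simp add: carry_append carry_Cons)
    finally have q: "q = (t + 1, carry a (take (Suc s) w0) j)" .
    have "relabel u p = (t, carry a (take s u) j)"
      using 3 unfolding p relabel_def by simp
    moreover have "relabel u q = (t + 1, carry a (take (Suc s) u) j)"
      using 3 unfolding q relabel_def by (simp del: take_Suc_Cons)
    moreover have "carry a (take (Suc s) u) j = flip (a + u ! s - 1) (carry a (take s u) j)"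
      unfolding take_Suc_conv_app_nth[OF sl(2)] by (simp add: carry_append carry_Cons)
    ultimately show ?thesis
      using segment_crossing[OF tu, of "a + u ! s - 1"] dgm_inside[OF u] 3 by simp
  qed
qed

lemma relabel_points:
  assumes u: "half_twist u"
  shows "relabel u ` points (tops B) (dgm w0) = points (tops B) (dgm u)"
proof -
  have wb: "\<forall>i\<in>set (take s v). 1 \<le> i \<and> a + i < width (tops B) X"
    "\<forall>i\<in>set (rev (take s v)). 1 \<le> i \<and> a + i < width (tops B) X" if "half_twist v" for v s
    using that width_X set_take_subset[of s v] by (fastforce simp: half_twist_def)+
  have iff: "relabel u (t, j) \<in> points (tops B) (dgm u) \<longleftrightarrow> (t, j) \<in> points (tops B) (dgm w0)" for t j
    using carry_less[OF wb(1)[OF u]] carry_less[OF wb(2)[OF half_twist_w0]]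
    by (auto simp: points_def relabel_def width_dgm[OF u] width_dgm[OF half_twist_w0]
        length_dgm[OF u] length_dgm[OF half_twist_w0] simp del: fill.simps)
  have surj: "\<exists>j'. relabel u (t, j') = (t, j)" for t j
  proof (cases "n \<le> t \<and> t \<le> n + 6")
    case True then show ?thesis using relabel_inverse by blast
  next
    case False then show ?thesis using relabel_fixed[OF u] by (metis nat_le_linear)
  qed
  show ?thesis
  proof (intro equalityI subsetI)
    fix p assume "p \<in> relabel u ` points (tops B) (dgm w0)"
    then show "p \<in> points (tops B) (dgm u)" using iff by force
  next
    fix p assume p: "p \<in> points (tops B) (dgm u)"
    obtain j' where "relabel u (fst p, j') = p" using surj[of "fst p" "snd p"] by auto
    then show "p \<in> relabel u ` points (tops B) (dgm w0)" using p iff by (metis image_eqI)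
  qed
qed

lemma relabelling:
  assumes u: "half_twist u"
  shows "relabelling B (dgm w0) (dgm u) (relabel u)"
proof
  have "p = p'" if "relabel u p = relabel u p'" for p p'
  proof -
    obtain t j t' j' where p: "p = (t, j)" "p' = (t', j')" by fastforce
    then have [simp]: "t' = t" using that by (auto simp: relabel_def split: if_splits)
    show ?thesis
    proof (cases "n \<le> t \<and> t \<le> n + 6")
      case True
      then show ?thesis using that p
        by (simp add: relabel_def) (metis carry_rev carry_rev')
    qed (use that p in \<open>auto simp: relabel_def split: if_splits\<close>)
  qed
  then show "inj (relabel u)" by (rule injI)
  show "length (dgm u) = length (dgm w0)" using length_dgm u half_twist_w0 by simp
  show "relabel u (0, j) = (0, j)" for j using relabel_fixed[OF u] by simp
  show "relabel u (length (dgm w0), j) = (length (dgm w0), j)" for j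
    using relabel_fixed[OF u] length_dgm[OF half_twist_w0] by simp
  show "dgm w0 \<noteq> []" by (simp add: braid_def w0_def)
qed (use relabel_segment relabel_points u in auto)

lemma time_relabel: "half_twist u \<Longrightarrow> time B (dgm u) (relabel u p) = time B (dgm w0) p"
  using relabelling.time[OF relabelling] string_link_w0 by blast

lemma time_fixed:
  assumes "half_twist u" "fst p \<le> n \<or> n + 6 \<le> fst p"
  shows "time B (dgm u) p = time B (dgm w0) p"
  using time_relabel[OF assms(1), of p] relabel_fixed[OF assms(1), of "fst p" "snd p"] assms(2) by simp

lemma pt_joined:
  assumes u: "half_twist u" "s < 6"
  shows "joined (dgm u) (pt u s b) (pt u (Suc s) b)"
proof -
  have l: "s < length u" using u by (simp add: half_twist_def)
  then have "u ! s \<in> {1, 2, 3}" using u nth_mem[OF l] unfolding half_twist_def by blast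
  then have l1: "1 \<le> u ! s" by auto
  have "carry 0 (take (Suc s) u) b = flip (u ! s - 1) (carry 0 (take s u) b)"
    unfolding take_Suc_conv_app_nth[OF l] by (simp add: carry_append carry_Cons)
  then have "a + carry 0 (take (Suc s) u) b = flip (a + u ! s - 1) (a + carry 0 (take s u) b)"
    using l1 by (auto simp: flip_def)
  then show ?thesis
    using segment_crossing[of "n + s" "dgm u" "a + u ! s - 1" "a + carry 0 (take s u) b"] u length_dgm
      dgm_inside by (simp add: joined_def pt_def del: fill.simps)
qed

text \<open>Consecutive points of a branch differ in time by one and distinct points have distinct
  times. The assumption that the branch goes down fixes the direction, so
  \<open>monotone_steps\<close> applies.\<close>

lemma time_pt_w0:
  assumes "b < 4" "s \<le> 6"
  shows "time B (dgm w0) (pt w0 s b) = T b + s"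
proof -
  let ?D = "dgm w0" let ?f = "\<lambda>s. time B ?D (pt w0 s b)"
  have ne: "?D \<noteq> []" by (simp add: braid_def w0_def)
  have P: "pt w0 s b \<in> points (tops B) ?D" if "s \<le> 6" for s
    using points_dgm[OF half_twist_w0 that assms(1)] .
  have len: "n + 6 \<le> length ?D" using length_dgm[OF half_twist_w0] by simp
  have "?f s = ?f 0 + s"
  proof (rule monotone_steps[of 6])
    fix s :: nat assume s: "s < 6"
    note j = pt_joined[OF half_twist_w0 s, of b]
    show "?f (Suc s) = Suc (?f s) \<or> ?f s = Suc (?f (Suc s))"
    \<comment> \<open>If \<open>X\<close> is empty, the point at height 0 lies on the boundary. The
      first step is therefore viewed from the point at height 1, which is interior.\<close>
    proof (cases "s = 0")
      case True
      have "?f s = Suc (?f (Suc s)) \<or> ?f (Suc s) = Suc (?f s)"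
        by (rule time_joined[OF string_link_w0 P])
         (use j len True in \<open>auto simp: pt_def joined_sym simp del: fill.simps\<close>)
      then show ?thesis by blast
    next
      case False
      show ?thesis
        by (rule time_joined[OF string_link_w0 P])
         (use j len False s in \<open>auto simp: pt_def simp del: fill.simps\<close>)
    qed
  next
    fix s :: nat assume "Suc s < 6"
    then show "?f s \<noteq> ?f (Suc (Suc s))"
      using time_inject[OF string_link_w0 ne P P, of s "Suc (Suc s)"] by (auto simp: pt_def simp del: fill.simps)
  next
    have "pt w0 0 b = (n, a + b)" "pt w0 6 b = (n + 6, a + 3 - b)"
      using assms(1) half_twist_w0 by (auto simp: pt_def half_twist_def)
    then show "?f 0 < ?f 6" using positive assms(1) by (simp add: Let_def w0_def)
  qed (use assms in auto)
  then show ?thesis by (simp add: T_def pt_def)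
qed

lemma time_pt:
  assumes "half_twist u" "b < 4" "s \<le> 6"
  shows "time B (dgm u) (pt u s b) = T b + s"
proof -
  have "\<forall>i\<in>set (take s v). 1 \<le> i" if "half_twist v" for v
    using that by (auto simp: half_twist_def dest!: in_set_takeD)
  then have shift: "a + carry 0 (take s v) b = carry a (take s v) (a + b)" if "half_twist v" for v
    using carry_shift that by metis
  have "relabel u (pt w0 s b) = pt u s b"
    using assms(3) unfolding pt_def shift[OF assms(1)] shift[OF half_twist_w0]
    by (simp add: relabel_def)
  then show ?thesis using time_relabel[OF assms(1)] time_pt_w0[OF assms(2,3)] by metis
qed

end

section \<open>The weights\<close>

text \<open>The branches \<open>0, \<dots>, 3\<close> of a half twist are numbered by their positions at the top, hence from
  below; \<open>low u s\<close> and \<open>high u s\<close> are those crossing in the layer \<open>s\<close>. The passage of the branch \<open>b\<close>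
  through the layer \<open>s\<close> is written \<open>(b, s)\<close>, and \<open>L\<close> is the order of the branches on the circle.\<close>

definition low :: "nat list \<Rightarrow> nat \<Rightarrow> nat" where
  "low u s = carry 0 (rev (take s u)) (u ! s - 1)"

definition high :: "nat list \<Rightarrow> nat \<Rightarrow> nat" where
  "high u s = carry 0 (rev (take s u)) (u ! s)"

definition events :: "nat list \<Rightarrow> (nat \<times> nat \<times> nat) list" where
  "events u = map (\<lambda>s. (s, low u s, high u s)) [0..<6]"

definition branch_pairs :: "(nat \<times> nat) list" where
  "branch_pairs = [(0, 1), (0, 2), (0, 3), (1, 2), (1, 3), (2, 3)]"

text \<open>Identifies the crossings in the hole with the pairs (lower branch, higher branch),
  whatever the word; only the layers of the crossings depend on it.\<close>

definition each_pair_once :: "nat list \<Rightarrow> bool" where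
  "each_pair_once u \<longleftrightarrow> distinct (map snd (events u)) \<and> set (map snd (events u)) = set branch_pairs"

definition prec :: "(nat \<Rightarrow> nat \<Rightarrow> bool) \<Rightarrow> nat \<times> nat \<Rightarrow> nat \<times> nat \<Rightarrow> bool" where
  "prec L p q \<longleftrightarrow> L (fst p) (fst q) \<or> fst p = fst q \<and> snd p < snd q"

text \<open>
  A weight is encoded by a list of keys, one for each summand: \<open>4 * i + j\<close> stands for \<open>N i j\<close>, \<open>16 + j\<close>
  for \<open>F j\<close>, and \<open>20\<close> for \<open>1\<close>. Equality of weights with \<open>N\<close> and \<open>F\<close> as formal variables thus becomes
  equality of sorted lists. \<open>keys1\<close> is the sum over the r-crossings for a crossing in the hole, \<open>keys2\<close>
  the sum over the f-crossings.
\<close>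

definition keys1 :: "(nat \<Rightarrow> nat \<Rightarrow> bool) \<Rightarrow> (nat \<times> nat \<times> nat) list \<Rightarrow> nat \<Rightarrow> nat \<Rightarrow> nat \<Rightarrow> nat list" where
  "keys1 L ev s l h = (4 * l + h) # map (\<lambda>_. 20) (filter (\<lambda>(s', l', h').
     prec L (l, s) (h', s') \<and> prec L (h', s') (h, s) \<and> prec L (h, s) (l', s')) ev)"

definition keys2 :: "(nat \<Rightarrow> nat \<Rightarrow> bool) \<Rightarrow> (nat \<times> nat \<times> nat) list \<Rightarrow> nat \<Rightarrow> nat \<Rightarrow> nat list" where
  "keys2 L ev s h = (16 + h) # concat (map (\<lambda>(s', l', h').
     if L l' h' \<and> prec L (l', s') (h, s) then keys1 L ev s' l' h' else []) ev)"

lemma half_twist_label: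
  assumes "half_twist u" "s < 6"
  shows "low u s < 4" "high u s < 4" "1 \<le> u ! s"
    "carry 0 (take s u) (low u s) = u ! s - 1" "carry 0 (take (Suc s) u) (low u s) = u ! s"
    "carry 0 (take s u) (high u s) = u ! s" "carry 0 (take (Suc s) u) (high u s) = u ! s - 1"
proof -
  have l: "s < length u" using assms by (simp add: half_twist_def)
  then have "u ! s \<in> {1, 2, 3}" using assms nth_mem[OF l] unfolding half_twist_def by blast
  then have s: "1 \<le> u ! s" "u ! s < 4" "u ! s - 1 < 4" by auto
  have "\<forall>i\<in>set (rev (take s u)). 1 \<le> i \<and> 0 + i < 4"
    using assms by (auto simp: half_twist_def dest!: in_set_takeD)
  then show "low u s < 4" "high u s < 4" using carry_less s by (auto simp: low_def high_def)
  show "1 \<le> u ! s" by (fact s)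
  show c: "carry 0 (take s u) (low u s) = u ! s - 1" "carry 0 (take s u) (high u s) = u ! s"
    by (simp_all add: low_def high_def)
  show "carry 0 (take (Suc s) u) (low u s) = u ! s" "carry 0 (take (Suc s) u) (high u s) = u ! s - 1"
    using s(1) unfolding take_Suc_conv_app_nth[OF l]
    by (auto simp: carry_append carry_Cons c flip_def)
qed

lemma tangle_layer:
  assumes "tangle k D l" "q < length D"
  shows "fst (D ! q) + ins (snd (D ! q)) \<le> width k (take q D)"
    and "width k (take (Suc q) D) = width k (take q D) - ins (snd (D ! q)) + outs (snd (D ! q))"
proof -
  obtain i g where g: "D ! q = (i, g)" by fastforce
  have "D = take q D @ (i, g) # drop (Suc q) D" using id_take_nth_drop[OF assms(2)] g by simp
  then have "tangle (width k (take q D)) ((i, g) # drop (Suc q) D) l"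
    using assms(1) tangle_append by metis
  then show "fst (D ! q) + ins (snd (D ! q)) \<le> width k (take q D)" using g by simp
  show "width k (take (Suc q) D) = width k (take q D) - ins (snd (D ! q)) + outs (snd (D ! q))"
    unfolding take_Suc_conv_app_nth[OF assms(2)] by (simp add: width_append g)
qed

lemma crossing_points:
  assumes "tangle k D l" "q \<in> crossings D" "j \<le> Suc (fst (D ! q))"
  shows "(q, j) \<in> points k D" "(Suc q, j) \<in> points k D"
  using tangle_layer[OF assms(1), of q] assms(2,3) by (auto simp: crossings_def points_def)

lemma sum_list_if_filter:
  fixes f :: "'a \<Rightarrow> int"
  shows "sum_list (map f (filter P xs)) = (\<Sum>x\<leftarrow>xs. if P x then f x else 0)"
  by (induction xs) auto

lemma (in quadruple) dgm_nonempty: "dgm w0 \<noteq> []"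
  by (simp add: braid_def w0_def)

declare fill.simps [simp del]

section \<open>Crossings inside and outside of the hole\<close>

context quadruple
begin

abbreviation un :: "nat \<Rightarrow> nat" where "un \<equiv> under_time B (dgm w0)"
abbreviation ov :: "nat \<Rightarrow> nat" where "ov \<equiv> over_time B (dgm w0)"
abbreviation wr :: "nat \<Rightarrow> int" where "wr \<equiv> writhe B (dgm w0)"

text \<open>Taken from the reference filling. All half twists have six layers, so the numbers of the
  layers outside of the hole are the same for each of them.\<close>

definition outer :: "nat set" where
  "outer = {q \<in> crossings (dgm w0). q < n \<or> n + 6 \<le> q}"

text \<open>The bounds make \<open>L\<close> equal as a function to some \<open>ranked r\<close>, so
  that the finite check can be applied to it.\<close>

definition L :: "nat \<Rightarrow> nat \<Rightarrow> bool" where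
  "L b b' \<longleftrightarrow> b < 4 \<and> b' < 4 \<and> T b < T b'"

text \<open>All branches go down through the hole, so a passage is timed at its upper point and
  every crossing is positive.\<close>

lemma crossing_times:
  assumes u: "half_twist u" and s: "s < 6"
  shows "under_time B (dgm u) (n + s) = T (low u s) + s"
    "over_time B (dgm u) (n + s) = T (high u s) + s" "writhe B (dgm u) (n + s) = 1"
proof -
  note l = half_twist_label[OF u s]
  have d: "dgm u ! (n + s) = (a + u ! s - 1, Pos)" using dgm_inside[OF u s] .
  have U: "under_branch (dgm u) (n + s) = (pt u s (low u s), pt u (Suc s) (low u s))"
    using l by (simp add: under_branch_def falling_branch_def pt_def d)
  have O: "over_branch (dgm u) (n + s) = (pt u s (high u s), pt u (Suc s) (high u s))"
    using l by (simp add: over_branch_def rising_branch_def pt_def d)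
  have t: "time B (dgm u) (pt u s b) = T b + s" "time B (dgm u) (pt u (Suc s) b) = T b + Suc s"
    if "b < 4" for b
    using time_pt[OF u that, of s] time_pt[OF u that, of "Suc s"] s by (simp_all)
  show "under_time B (dgm u) (n + s) = T (low u s) + s"
    "over_time B (dgm u) (n + s) = T (high u s) + s" "writhe B (dgm u) (n + s) = 1"
    by (simp_all add: under_time_def over_time_def passage_def writhe_def goes_down_def U O t l d)
qed

lemma outer_crossing:
  assumes u: "half_twist u" and q: "q < n \<or> n + 6 \<le> q"
  shows "under_time B (dgm u) q = un q" "over_time B (dgm u) q = ov q"
    "writhe B (dgm u) q = wr q" "dgm u ! q = dgm w0 ! q"
proof -
  show same: "dgm u ! q = dgm w0 ! q"
  proof (cases "q < n")
    case True then show ?thesis using dgm_before by simp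
  next
    case False
    then obtain y where "q = n + 6 + y" using q by (metis le_Suc_ex)
    then show ?thesis using dgm_after[OF u] dgm_after[OF half_twist_w0] by simp
  qed
  have t: "time B (dgm u) (q, j) = time B (dgm w0) (q, j)"
    "time B (dgm u) (Suc q, j) = time B (dgm w0) (Suc q, j)" for j
    using time_fixed[OF u] q by auto
  show "under_time B (dgm u) q = un q" "over_time B (dgm u) q = ov q" "writhe B (dgm u) q = wr q"
    by (simp_all add: under_time_def over_time_def passage_def writhe_def goes_down_def
        under_branch_def over_branch_def falling_branch_def rising_branch_def same t)
qed

lemma crossings_dgm:
  assumes u: "half_twist u"
  shows "crossings (dgm u) = outer \<union> (\<lambda>s. n + s) ` {..<6}"
proof -
  have "q \<in> crossings (dgm u) \<longleftrightarrow> q \<in> outer \<union> (\<lambda>s. n + s) ` {..<6}" for q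
  proof (cases "q < n \<or> n + 6 \<le> q")
    case True
    then have "q \<notin> (\<lambda>s. n + s) ` {..<6}" by auto
    then show ?thesis using outer_crossing(4)[OF u True] True length_dgm[OF u] length_dgm[OF half_twist_w0]
      by (simp add: crossings_def outer_def)
  next
    case False
    then obtain s where "q = n + s" "s < 6" by (metis le_add_diff_inverse linorder_not_less nat_add_left_cancel_less)
    then show ?thesis using dgm_inside[OF u] length_dgm[OF u] by (simp add: crossings_def)
  qed
  then show ?thesis by blast
qed

lemma sum_crossings:
  fixes g :: "nat \<Rightarrow> int"
  assumes u: "half_twist u"
  shows "(\<Sum>q\<in>{q \<in> crossings (dgm u). P q}. g q) =
    (\<Sum>q\<in>{q \<in> outer. P q}. g q) + (\<Sum>s\<leftarrow>[0..<6]. if P (n + s) then g (n + s) else 0)"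
proof -
  have fin: "finite outer" by (simp add: outer_def crossings_def)
  have dis: "outer \<inter> (\<lambda>s. n + s) ` {..<6} = {}" by (auto simp: outer_def)
  have "(\<Sum>q\<in>{q \<in> crossings (dgm u). P q}. g q) = (\<Sum>q\<in>crossings (dgm u). if P q then g q else 0)"
    by (rule sum.inter_filter) (simp add: crossings_def)
  also have "\<dots> = (\<Sum>q\<in>outer. if P q then g q else 0) + (\<Sum>q\<in>(\<lambda>s. n + s) ` {..<6}. if P q then g q else 0)"
    unfolding crossings_dgm[OF u] by (rule sum.union_disjoint) (use fin dis in auto)
  also have "(\<Sum>q\<in>outer. if P q then g q else 0) = (\<Sum>q\<in>{q \<in> outer. P q}. g q)"
    by (rule sum.inter_filter[symmetric]) (fact fin)
  also have "(\<Sum>q\<in>(\<lambda>s. n + s) ` {..<6}. if P q then g q else 0) = (\<Sum>s\<leftarrow>[0..<6]. if P (n + s) then g (n + s) else 0)"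
    by (subst sum.reindex) (simp_all add: inj_on_def comp_def interv_sum_list_conv_sum_set_nat atLeast0LessThan)
  finally show ?thesis .
qed

lemma time_at_pt:
  assumes "b < 4" "s \<le> 6" "p \<in> points (tops B) (dgm w0)" "time B (dgm w0) p = T b + s"
  shows "p = pt w0 s b"
proof (rule time_inject[OF string_link_w0 dgm_nonempty])
qed (use assms points_dgm[OF half_twist_w0] time_pt_w0 in auto)

text \<open>The seven points of the branch \<open>b\<close> fill the times from \<open>T b\<close>
  to \<open>T b + 6\<close>. If another branch entered in this interval, two distinct points would
  have the same time.\<close>

lemma T_gap:
  assumes "b < 4" "b' < 4" "T b \<le> T b'" "b \<noteq> b'"
  shows "T b + 6 < T b'"
proof (rule ccontr)
  assume "\<not> ?thesis"
  then obtain s where s: "s \<le> 6" "T b' = T b + s" using assms(3) by (metis le_Suc_ex nat_add_left_cancel_le not_less)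
  then have "pt w0 0 b' = pt w0 s b"
    using time_at_pt[OF assms(1), of s "pt w0 0 b'"] points_dgm[OF half_twist_w0, of 0 b'] time_pt_w0[of b' 0] assms(2)
    by simp
  then show False using assms(4) by (auto simp: pt_def)
qed

text \<open>Distinct branches occupy disjoint intervals of time, so their passages compare as the
  branches do; on one branch the layers decide.\<close>

lemma prec_times:
  assumes "b < 4" "b' < 4" "s \<le> 6" "s' \<le> 6"
  shows "T b + s < T b' + s' \<longleftrightarrow> prec L (b, s) (b', s')"
proof (cases "b = b'")
  case False
  then have "T b + 6 < T b' \<or> T b' + 6 < T b"
    using T_gap[OF assms(1,2)] T_gap[OF assms(2,1)] by (metis nat_le_linear)
  then show ?thesis using False assms by (auto simp: prec_def L_def)
qed (simp add: prec_def L_def)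

text \<open>The point of minimal time would lie on the branch \<open>b\<close>. The bound
  \<open>T b + 6\<close> itself is allowed, because a crossing directly below the hole may be passed
  from the exit point of the branch.\<close>

lemma outer_passage_segment:
  assumes q: "q < n \<or> n + 6 \<le> q" and b: "b < 4"
    and P: "(q, i) \<in> points (tops B) (dgm w0)" "(Suc q, j) \<in> points (tops B) (dgm w0)"
    and J: "joined (dgm w0) (q, i) (Suc q, j)"
  shows "passage B (dgm w0) ((q, i), (Suc q, j)) < T b \<or> T b + 6 \<le> passage B (dgm w0) ((q, i), (Suc q, j))"
proof (rule ccontr)
  let ?t = "time B (dgm w0)" let ?m = "min (?t (q, i)) (?t (Suc q, j))"
  assume "\<not> ?thesis"
  then have m: "T b \<le> ?m" "?m < T b + 6" by (auto simp: passage_def)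
  then obtain s where s: "s < 6" "?m = T b + s" by (metis le_Suc_ex nat_add_left_cancel_less)
  have "(q, i) = pt w0 s b \<or> (Suc q, j) = pt w0 s b"
    using time_at_pt[OF b _ P(1)] time_at_pt[OF b _ P(2)] s by (auto simp: min_def split: if_splits)
  then have sq: "q = n + s \<or> Suc q = n + s" by (auto simp: pt_def)
  \<comment> \<open>Only a crossing directly above the hole is left. If it were passed after
    \<open>T b\<close>, its upper point would have the time of the next point of the branch inside
    the hole.\<close>
  then have n: "Suc q = n" "s = 0" using q s(1) by auto
  have len: "n < length (dgm w0)" "0 < n" using length_dgm[OF half_twist_w0] n by auto
  have t2: "?t (Suc q, j) = T b"
    using \<open>(q, i) = pt w0 s b \<or> (Suc q, j) = pt w0 s b\<close> n time_pt_w0[OF b, of 0]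
    by (auto simp: pt_def)
  have "joined (dgm w0) (Suc q, j) (q, i)" using J joined_sym by blast
  then have "?t (q, i) = Suc (T b)"
    using time_joined[OF string_link_w0 P(2), of "(q, i)"] len n t2 m(1) by auto
  then have "(q, i) = pt w0 1 b" using time_at_pt[OF b _ P(1), of 1] by simp
  then show False using n by (simp add: pt_def)
qed

lemma outer_passage:
  assumes "q \<in> outer" "b < 4"
  shows "un q < T b \<or> T b + 6 \<le> un q" "ov q < T b \<or> T b + 6 \<le> ov q"
proof -
  let ?D = "dgm w0"
  have tg: "tangle (tops B) ?D (bottoms B)" using string_link_w0 by (simp add: string_link_def)
  have q: "q \<in> crossings ?D" "q < n \<or> n + 6 \<le> q" using assms by (auto simp: outer_def)
  obtain i g where "?D ! q = (i, g)" by fastforce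
  then have g: "?D ! q = (i, g)" "q < length ?D" "g \<in> {Pos, Neg}"
    using q(1) by (auto simp: crossings_def)
  have J: "joined ?D (q, i) (Suc q, Suc i)" "joined ?D (q, Suc i) (Suc q, i)"
    using segment.falling[OF g(2,1,3)] segment.rising[OF g(2,1,3)] by (auto simp: joined_def)
  note P = crossing_points[OF tg q(1)]
  have "passage B ?D (falling_branch ?D q) < T b \<or> T b + 6 \<le> passage B ?D (falling_branch ?D q)"
    "passage B ?D (rising_branch ?D q) < T b \<or> T b + 6 \<le> passage B ?D (rising_branch ?D q)"
    using outer_passage_segment[OF q(2) assms(2) P(1) P(2) J(1)]
      outer_passage_segment[OF q(2) assms(2) P(1) P(2) J(2)] g(1)
    by (simp_all add: falling_branch_def rising_branch_def)
  then show "un q < T b \<or> T b + 6 \<le> un q" "ov q < T b \<or> T b + 6 \<le> ov q"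
    by (simp_all add: under_time_def over_time_def under_branch_def over_branch_def)
qed

text \<open>The share of the outer crossings in the sum over the r-crossings for the crossing of the
  branches \<open>i\<close> (under) and \<open>j\<close> (over). Entry times suffice, since no outer
  crossing is passed while a branch runs through the hole.\<close>

definition N :: "nat \<Rightarrow> nat \<Rightarrow> int" where
  "N i j = (\<Sum>r\<in>{r \<in> outer. T i < ov r \<and> ov r < T j \<and> T j < un r}. wr r)"

text \<open>The factor of \<open>wr f\<close> counts the r-crossings for \<open>f\<close>; those in the hole are counted by the
  pairs of branches, so that the result is independent of the word in the hole.\<close>

definition F :: "nat \<Rightarrow> int" where
  "F j = (\<Sum>f\<in>{f \<in> outer. un f < ov f \<and> un f < T j}. wr f *
     ((\<Sum>r\<in>{r \<in> outer. un f < ov r \<and> ov r < ov f \<and> ov f < un r}. wr r) +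
      (\<Sum>(l, h)\<leftarrow>branch_pairs. if un f < T h \<and> T h < ov f \<and> ov f < T l then 1 else 0)))"

section \<open>Weights as values of key lists\<close>

definition val :: "nat list \<Rightarrow> int" where
  "val ks = (\<Sum>k\<leftarrow>ks. if k < 16 then N (k div 4) (k mod 4) else if k < 20 then F (k - 16) else 1)"

text \<open>The outer r-crossings give \<open>N\<close>; those in the hole have writhe 1, and each
  gives a key \<open>20\<close>.\<close>

lemma val_keys1:
  assumes u: "half_twist u" and s: "s < 6"
  shows "(\<Sum>r\<in>r_crossings B (dgm u) (n + s). writhe B (dgm u) r) =
    val (keys1 L (events u) s (low u s) (high u s))"
proof -
  let ?D = "dgm u" and ?l = "low u s" and ?h = "high u s"
  note lh = half_twist_label(1,2)[OF u s]
  let ?P = "\<lambda>r. T ?l + s < over_time B ?D r \<and> over_time B ?D r < T ?h + s \<and> T ?h + s < under_time B ?D r"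
  have "r_crossings B ?D (n + s) = {r \<in> crossings ?D. ?P r}"
    by (simp add: r_crossings_def crossing_times[OF u s])
  then have "(\<Sum>r\<in>r_crossings B ?D (n + s). writhe B ?D r) =
     (\<Sum>r\<in>{r \<in> outer. ?P r}. writhe B ?D r) + (\<Sum>t\<leftarrow>[0..<6]. if ?P (n + t) then writhe B ?D (n + t) else 0)"
    using sum_crossings[OF u] by simp
  also have "(\<Sum>r\<in>{r \<in> outer. ?P r}. writhe B ?D r) = N ?l ?h"
    unfolding N_def
  proof (rule sum.cong)
    have "?P r \<longleftrightarrow> T ?l < ov r \<and> ov r < T ?h \<and> T ?h < un r" if "r \<in> outer" for r
      using outer_passage[OF that lh(1)] outer_passage[OF that lh(2)] outer_crossing[OF u, of r] that s
      by (auto simp: outer_def)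
    then show "{r \<in> outer. ?P r} = {r \<in> outer. T ?l < ov r \<and> ov r < T ?h \<and> T ?h < un r}" by blast
  qed (use outer_crossing[OF u] in \<open>auto simp: outer_def\<close>)
  also have "(\<Sum>t\<leftarrow>[0..<6]. if ?P (n + t) then writhe B ?D (n + t) else 0) =
    (\<Sum>t\<leftarrow>[0..<6]. if prec L (?l, s) (high u t, t) \<and> prec L (high u t, t) (?h, s)
       \<and> prec L (?h, s) (low u t, t) then 1 else 0)"
  proof (rule arg_cong[of _ _ sum_list], rule map_cong[OF refl])
    fix t assume "t \<in> set [0..<6]"
    then have t: "t < 6" by simp
    note lt = half_twist_label(1,2)[OF u t]
    show "(if ?P (n + t) then writhe B ?D (n + t) else 0) = (if prec L (?l, s) (high u t, t) \<and> prec L (high u t, t) (?h, s)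
       \<and> prec L (?h, s) (low u t, t) then 1 else 0)"
      using lh lt s t by (simp add: crossing_times[OF u t] prec_times)
  qed
  finally show ?thesis using lh
    by (simp add: keys1_def events_def val_def comp_def sum_list_if_filter filter_map case_prod_unfold del: upt_rec_numeral)
qed

lemma val_append: "val (xs @ ys) = val xs + val ys"
  by (simp add: val_def)

lemma val_concat: "val (concat xss) = (\<Sum>xs\<leftarrow>xss. val xs)"
  by (induction xss) (simp_all add: val_append, simp add: val_def)

text \<open>No passage of \<open>f\<close> separates the points of a branch in the hole, so a
  crossing in layer \<open>t\<close> can be timed by the entry times of its branches. Each pair of
  branches then contributes once, for every word.\<close>

lemma outer_r_sum:
  assumes u: "half_twist u" "each_pair_once u" and f: "f \<in> outer"
  shows "(\<Sum>r\<in>r_crossings B (dgm u) f. writhe B (dgm u) r) =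
    (\<Sum>r\<in>{r \<in> outer. un f < ov r \<and> ov r < ov f \<and> ov f < un r}. wr r) +
    (\<Sum>(l, h)\<leftarrow>branch_pairs. if un f < T h \<and> T h < ov f \<and> ov f < T l then 1 else 0)"
proof -
  let ?D = "dgm u"
  let ?P = "\<lambda>r. un f < over_time B ?D r \<and> over_time B ?D r < ov f \<and> ov f < under_time B ?D r"
  let ?c = "\<lambda>(l, h). if un f < T h \<and> T h < ov f \<and> ov f < T l then 1 else 0 :: int"
  have fo: "f < n \<or> n + 6 \<le> f" using f by (auto simp: outer_def)
  have "r_crossings B ?D f = {r \<in> crossings ?D. ?P r}"
    by (simp add: r_crossings_def outer_crossing[OF u(1) fo])
  then have "(\<Sum>r\<in>r_crossings B ?D f. writhe B ?D r) =
     (\<Sum>r\<in>{r \<in> outer. ?P r}. writhe B ?D r) + (\<Sum>t\<leftarrow>[0..<6]. if ?P (n + t) then writhe B ?D (n + t) else 0)"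
    using sum_crossings[OF u(1)] by simp
  also have "(\<Sum>r\<in>{r \<in> outer. ?P r}. writhe B ?D r) =
    (\<Sum>r\<in>{r \<in> outer. un f < ov r \<and> ov r < ov f \<and> ov f < un r}. wr r)"
    using outer_crossing[OF u(1)] by (intro sum.cong) (auto simp: outer_def)
  also have "(\<Sum>t\<leftarrow>[0..<6]. if ?P (n + t) then writhe B ?D (n + t) else 0) = (\<Sum>t\<leftarrow>[0..<6]. ?c (low u t, high u t))"
  proof (rule arg_cong[of _ _ sum_list], rule map_cong[OF refl])
    fix t assume "t \<in> set [0..<6]"
    then have t: "t < 6" by simp
    note lt = half_twist_label(1,2)[OF u(1) t]
    show "(if ?P (n + t) then writhe B ?D (n + t) else 0) = ?c (low u t, high u t)"
    proof -
      have "un f < T (high u t) + t \<longleftrightarrow> un f < T (high u t)"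
        "T (high u t) + t < ov f \<longleftrightarrow> T (high u t) < ov f"
        "ov f < T (low u t) + t \<longleftrightarrow> ov f < T (low u t)"
        using outer_passage[OF f lt(1)] outer_passage[OF f lt(2)] t by linarith+
      then show ?thesis by (simp add: crossing_times[OF u(1) t])
    qed
  qed
  also have "\<dots> = (\<Sum>p\<leftarrow>map snd (events u). ?c p)" by (simp add: events_def comp_def del: upt_rec_numeral)
  also have "\<dots> = (\<Sum>p\<in>set branch_pairs. ?c p)"
    using u(2) sum_list_distinct_conv_sum_set[of "map snd (events u)" ?c] by (simp add: each_pair_once_def)
  also have "\<dots> = (\<Sum>p\<leftarrow>branch_pairs. ?c p)"
    by (rule sum_list_distinct_conv_sum_set[symmetric]) (simp add: branch_pairs_def)
  finally show ?thesis by simp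
qed

lemma val_keys2:
  assumes u: "half_twist u" "each_pair_once u" and s: "s < 6" and d: "\<not> type1 B (dgm u) (n + s)"
  shows "(\<Sum>f\<in>f_crossings B (dgm u) (n + s). \<Sum>r\<in>r_crossings B (dgm u) f. writhe B (dgm u) f * writhe B (dgm u) r) =
    val (keys2 L (events u) s (high u s))"
proof -
  let ?D = "dgm u" and ?h = "high u s"
  note h = half_twist_label(2)[OF u(1) s]
  let ?P = "\<lambda>f. under_time B ?D f < over_time B ?D f \<and> under_time B ?D f < T ?h + s"
  let ?R = "\<lambda>f. writhe B ?D f * (\<Sum>r\<in>r_crossings B ?D f. writhe B ?D r)"
  \<comment> \<open>A crossing of type 1 differs from the one in layer \<open>s\<close> by the
    assumption \<open>d\<close>.\<close>
  have "f_crossings B ?D (n + s) = {f \<in> crossings ?D. ?P f}"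
    using d by (auto simp: f_crossings_def type1_def crossing_times[OF u(1) s])
  then have "(\<Sum>f\<in>f_crossings B ?D (n + s). \<Sum>r\<in>r_crossings B ?D f. writhe B ?D f * writhe B ?D r) =
    (\<Sum>f\<in>{f \<in> crossings ?D. ?P f}. ?R f)"
    by (simp add: sum_distrib_left)
  also have "\<dots> = (\<Sum>f\<in>{f \<in> outer. ?P f}. ?R f) + (\<Sum>t\<leftarrow>[0..<6]. if ?P (n + t) then ?R (n + t) else 0)"
    by (rule sum_crossings[OF u(1)])
  also have "(\<Sum>f\<in>{f \<in> outer. ?P f}. ?R f) = F ?h"
    unfolding F_def
  proof (rule sum.cong)
    have "?P f \<longleftrightarrow> un f < ov f \<and> un f < T ?h" if "f \<in> outer" for f
      using outer_passage[OF that h] outer_crossing[OF u(1), of f] that s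
      by (auto simp: outer_def)
    then show "{f \<in> outer. ?P f} = {f \<in> outer. un f < ov f \<and> un f < T ?h}" by blast
  next
    fix f assume "f \<in> {f \<in> outer. un f < ov f \<and> un f < T ?h}"
    then have f: "f \<in> outer" by simp
    then have "writhe B ?D f = wr f" using outer_crossing[OF u(1)] by (auto simp: outer_def)
    then show "?R f = wr f *
     ((\<Sum>r\<in>{r \<in> outer. un f < ov r \<and> ov r < ov f \<and> ov f < un r}. wr r) +
      (\<Sum>(l, h)\<leftarrow>branch_pairs. if un f < T h \<and> T h < ov f \<and> ov f < T l then 1 else 0))"
      using outer_r_sum[OF u f] by simp
  qed
  also have "(\<Sum>t\<leftarrow>[0..<6]. if ?P (n + t) then ?R (n + t) else 0) =
    (\<Sum>t\<leftarrow>[0..<6]. val (if L (low u t) (high u t) \<and> prec L (low u t, t) (?h, s)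
        then keys1 L (events u) t (low u t) (high u t) else []))"
  proof (rule arg_cong[of _ _ sum_list], rule map_cong[OF refl])
    fix t assume "t \<in> set [0..<6]"
    then have t: "t < 6" by simp
    note lt = half_twist_label(1,2)[OF u(1) t]
    have "?R (n + t) = val (keys1 L (events u) t (low u t) (high u t))"
      using val_keys1[OF u(1) t] crossing_times[OF u(1) t] by simp
    moreover have "?P (n + t) \<longleftrightarrow> L (low u t) (high u t) \<and> prec L (low u t, t) (?h, s)"
      using h lt s t by (simp add: crossing_times[OF u(1) t] prec_times L_def)
    ultimately show "(if ?P (n + t) then ?R (n + t) else 0) =
      val (if L (low u t) (high u t) \<and> prec L (low u t, t) (?h, s)
        then keys1 L (events u) t (low u t) (high u t) else [])"
      by (simp add: val_def)
  qed
  also have "\<dots> = val (concat (map (\<lambda>(s', l', h').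
     if L l' h' \<and> prec L (l', s') (?h, s) then keys1 L (events u) s' l' h' else []) (events u)))"
  proof -
    define K where "K = keys1 L (events u)"
    show ?thesis unfolding K_def[symmetric]
      by (simp add: val_concat events_def comp_def del: upt_rec_numeral)
  qed
  finally show ?thesis using h by (simp add: keys2_def val_def)
qed

end

section \<open>The entries of the meridian\<close>

text \<open>\<open>(x, s, y)\<close> is a triple crossing of the meridian in the notation of \<open>meridian\<close>.\<close>

type_synonym entry = "nat list \<times> nat \<times> nat list"

fun word :: "entry \<Rightarrow> nat list \<Rightarrow> nat list" where
  "word (x, s, y) w = x @ map ((+) s) w @ y"

text \<open>For \<open>i = 0, 1, 2\<close> these are the low, mid and high branches of the triple
  crossing, traced back through \<open>x\<close> to the top of the hole.\<close>

fun branch :: "entry \<Rightarrow> nat \<Rightarrow> nat" where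
  "branch (x, s, y) i = carry 0 (rev x) (s + i)"

fun hm_layer :: "entry \<Rightarrow> nat list \<Rightarrow> nat" where
  "hm_layer (x, s, y) w = length x + (if w = [1, 2, 1] then 2 else 0)"

fun d_layer :: "entry \<Rightarrow> nat" where
  "d_layer (x, s, y) = length x + 1"

text \<open>The two alternatives are the global types \<open>r_a\<close> and
  \<open>l_c\<close>.\<close>

definition x_keys :: "(nat \<Rightarrow> nat \<Rightarrow> bool) \<Rightarrow> entry \<Rightarrow> nat list \<Rightarrow> nat list" where
  "x_keys L e w = (let l = branch e 0; m = branch e 1; h = branch e 2 in
     if L m h \<and> L h l \<or> L m l \<and> L l h then keys1 L (events (word e w)) (hm_layer e w) m h else [])"

definition y_keys :: "(nat \<Rightarrow> nat \<Rightarrow> bool) \<Rightarrow> entry \<Rightarrow> nat list \<Rightarrow> nat list" where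
  "y_keys L e w = (if L (branch e 0) (branch e 2) then []
     else keys2 L (events (word e w)) (d_layer e) (branch e 2))"

text \<open>The order is that of \<open>meridian\<close>: the first four entries have sign 1, the
  last four have sign -1.\<close>

definition entries :: "entry list" where
  "entries = [([], 0, [3, 2, 1]), ([2, 1], 1, [1]), ([2, 3], 0, [3]), ([], 1, [1, 2, 3]),
     ([3, 2, 1], 1, []), ([3], 0, [3, 2]), ([1], 1, [1, 2]), ([1, 2, 3], 0, [])]"

text \<open>Collects what is verified by evaluation for each filled triple crossing: the word is a
  half twist, and its crossings \<open>hm\<close> and \<open>d\<close> lie in the expected layers
  between the expected branches.\<close>

definition regular :: "entry \<Rightarrow> nat list \<Rightarrow> bool" where
  "regular e w \<longleftrightarrow> (let u = word e w in half_twist u \<and> each_pair_once u \<and>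
     branch e 0 < 4 \<and> branch e 1 < 4 \<and> branch e 2 < 4 \<and> length (fst e) \<le> 3 \<and>
     low u (hm_layer e w) = branch e 1 \<and> high u (hm_layer e w) = branch e 2 \<and>
     low u (d_layer e) = branch e 0 \<and> high u (d_layer e) = branch e 2)"

lemma regular_entries: "list_all (\<lambda>e. list_all (regular e) [[1, 2, 1], [2, 1, 2]]) entries"
  by code_simp

section \<open>The finite check over all orders of the branches\<close>

definition ranked :: "nat list \<Rightarrow> nat \<Rightarrow> nat \<Rightarrow> bool" where
  "ranked r i j \<longleftrightarrow> i < 4 \<and> j < 4 \<and> r ! i < r ! j"

text \<open>The 24 permutations; \<open>r ! i\<close> is the rank of the branch \<open>i\<close> in
  the order on the circle.\<close>

definition rankings :: "nat list list" where
  "rankings = filter distinct (List.product_lists (replicate 4 [0, 1, 2, 3]))"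

text \<open>The first two equations say that both perturbations give the same weights. The others
  are linear relations between formal sums, with \<open>x 2 = y 4 - y 0\<close> written without
  subtraction.\<close>

definition balanced :: "(nat \<Rightarrow> nat \<Rightarrow> bool) \<Rightarrow> bool" where
  "balanced L \<longleftrightarrow> (let xs = map (\<lambda>e. sort (x_keys L e [1, 2, 1])) entries;
     ys = map (\<lambda>e. sort (y_keys L e [1, 2, 1])) entries in
     xs = map (\<lambda>e. sort (x_keys L e [2, 1, 2])) entries \<and>
     ys = map (\<lambda>e. sort (y_keys L e [2, 1, 2])) entries \<and>
     sort (xs ! 0 @ xs ! 1) = sort (xs ! 4 @ xs ! 5) \<and> sort (xs ! 2 @ ys ! 0) = ys ! 4 \<and>
     xs ! 6 = xs ! 2 \<and> xs ! 7 = xs ! 3 \<and>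
     ys ! 2 = ys ! 1 \<and> ys ! 5 = ys ! 1 \<and> ys ! 6 = ys ! 1 \<and> ys ! 7 = ys ! 3)"

lemma balanced_rankings: "list_all (\<lambda>r. balanced (ranked r)) rankings"
  by code_simp

section \<open>Skein relations between the entries\<close>

definition braid_moves :: "(nat list \<times> nat list) list" where
  "braid_moves = [([1, 2, 1], [2, 1, 2]), ([2, 3, 2], [3, 2, 3]), ([1, 3], [3, 1])]"

text \<open>An executable form of one braid relation or far commutation, in either direction. A
  smoothed word has five letters, hence the range of \<open>k\<close>.\<close>

definition braid_step :: "nat list \<Rightarrow> nat list \<Rightarrow> bool" where
  "braid_step u u' \<longleftrightarrow> (\<exists>(l, r)\<in>set braid_moves. \<exists>k\<in>set [0..<5].
     let p = take k u; q = drop (k + length l) u in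
       u = p @ l @ q \<and> u' = p @ r @ q \<or> u = p @ r @ q \<and> u' = p @ l @ q)"

lemma braid_append: "braid j (u @ u') = braid j u @ braid j u'"
  by (simp add: braid_def)

lemma braid_moves_move:
  assumes "(l, r) \<in> set braid_moves"
  shows "move (braid a l) (braid a r)"
proof -
  have "move [(a, Pos), (a + 2, Pos)] [(a + 2, Pos), (a, Pos)]"
    using exchange[of a Pos "a + 2" Pos] by simp
  moreover have "move [(a, Pos), (a + 1, Pos), (a, Pos)] [(a + 1, Pos), (a, Pos), (a + 1, Pos)]"
    "move [(a + 1, Pos), (a + 2, Pos), (a + 1, Pos)] [(a + 2, Pos), (a + 1, Pos), (a + 2, Pos)]"
    using reidemeister3[of a] reidemeister3[of "a + 1"] by simp_all
  ultimately show ?thesis using assms by (auto simp: braid_moves_def braid_def)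
qed

lemma tangle_braid:
  assumes "\<forall>i\<in>set u. 1 \<le> i \<and> j + i + 1 \<le> k"
  shows "tangle k (braid j u) k"
  using assms
proof (induction u)
  case (Cons i u)
  then have "Suc (Suc (k - 2)) = k" by auto
  then show ?case using Cons by (auto simp: braid_def)
qed (simp add: braid_def)

context quadruple
begin

definition skein_eq :: "nat list \<Rightarrow> nat list \<Rightarrow> bool" where
  "skein_eq u u' \<longleftrightarrow> dia (dgm u) - dia (dgm u') \<in> kauffman.span (skein_relators (tops B) (bottoms B))"

lemma skein_eq_trans: "skein_eq u u' \<Longrightarrow> skein_eq u' w \<Longrightarrow> skein_eq u w"
  unfolding skein_eq_def by (drule (1) kauffman.span_add) simp

lemma skein_eq_sym: "skein_eq u u' \<Longrightarrow> skein_eq u' u"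
  unfolding skein_eq_def by (drule kauffman.span_neg) simp

lemma tangle_dgm:
  assumes "set u \<subseteq> {1, 2, 3}"
  shows "tangle (tops B) (dgm u) (bottoms B)"
proof -
  let ?k = "width (tops B) X"
  have w: "width ?k (braid a u') = ?k" for u' using width_braid width_X by simp
  have "tangle (tops B) (dgm w0) (bottoms B)" using string_link_w0 by (simp add: string_link_def)
  then have t: "tangle (tops B) X ?k" "tangle ?k Y (bottoms B)"
    by (auto simp: fill.simps tangle_append w)
  have "tangle ?k (braid a u) ?k" using assms width_X by (intro tangle_braid) auto
  then show ?thesis using t by (simp add: fill.simps tangle_append w)
qed

lemma skein_eq_step:
  assumes "braid_step u u'" "set u \<subseteq> {1, 2, 3}" "set u' \<subseteq> {1, 2, 3}"
  shows "skein_eq u u'"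
proof -
  have base: "skein_eq (p @ l @ q) (p @ r @ q)"
    if "(l, r) \<in> set braid_moves" "set (p @ l @ q) \<subseteq> {1, 2, 3}" "set (p @ r @ q) \<subseteq> {1, 2, 3}" for p q l r
  proof -
    have f: "dgm (p @ w @ q) = (X @ braid a p) @ braid a w @ (braid a q @ Y)" for w
      by (simp add: fill.simps braid_append)
    have "dia (dgm (p @ l @ q)) - dia (dgm (p @ r @ q)) \<in> skein_relators (tops B) (bottoms B)"
      using isotopy[OF braid_moves_move[OF that(1), of a], of "tops B" "X @ braid a p" "braid a q @ Y" "bottoms B"]
        tangle_dgm[OF that(2)] tangle_dgm[OF that(3)] unfolding f by blast
    then show ?thesis unfolding skein_eq_def by (rule kauffman.span_base)
  qed
  obtain p l r q where "(l, r) \<in> set braid_moves"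
    "u = p @ l @ q \<and> u' = p @ r @ q \<or> u = p @ r @ q \<and> u' = p @ l @ q"
    using assms(1) unfolding braid_step_def Let_def by fast
  then show ?thesis using base[of l r p q] assms(2,3) skein_eq_sym by metis
qed

lemma skein_eq_path:
  assumes "successively braid_step us" "us \<noteq> []" "list_all (\<lambda>u. set u \<subseteq> {1, 2, 3}) us"
  shows "skein_eq (hd us) (last us)"
  using assms
proof (induction us rule: induct_list012)
  case (2 w)
  show ?case by (simp add: skein_eq_def kauffman.span_zero)
next
  case (3 u w us)
  have "braid_step u w" "set u \<subseteq> {1, 2, 3}" "set w \<subseteq> {1, 2, 3}"
    using 3(3,5) by (simp_all only: successively.simps list.pred_inject)
  then have "skein_eq u w" by (rule skein_eq_step)
  moreover have "skein_eq (hd (w # us)) (last (w # us))"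
    using 3(3,5) by (intro 3(2)) (simp_all only: successively.simps list.pred_inject not_False_eq_True list.distinct)
  ultimately have "skein_eq u (last (w # us))" unfolding list.sel by (rule skein_eq_trans)
  then show ?case by (simp only: list.sel last.simps list.distinct if_False)
qed simp

text \<open>Each pair is connected by an explicit chain of braid moves, checked by evaluation. The
  first two pairs cancel terms with \<open>\<sigma>\<^sub>2\<sigma>\<^sub>1\<close>, the next two
  match such terms with squares in the fifth entry, and the remaining eight match squares with
  squares.\<close>

lemma skein_eq_words:
  "skein_eq [2,1,3,2,1] [3,2,1,3,2]" "skein_eq [3,2,1,2,3] [1,2,3,2,1]"
  "skein_eq [2,3,2,1,3] [3,2,1,3,3]" "skein_eq [1,3,2,1,2] [3,2,1,2,2]"
  "skein_eq [2,2,3,2,1] [3,2,1,3,3]" "skein_eq [1,1,3,2,1] [3,2,1,2,2]"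
  "skein_eq [2,1,3,3,1] [2,3,1,1,3]" "skein_eq [2,1,2,2,1] [1,2,2,1,2]"
  "skein_eq [2,3,2,2,3] [3,2,2,3,2]" "skein_eq [3,1,1,3,2] [1,3,3,1,2]"
  "skein_eq [3,3,1,2,3] [1,2,3,2,2]" "skein_eq [2,2,1,2,3] [1,2,3,1,1]"
proof -
  have path: "skein_eq (hd us) (last us)"
    if "us \<noteq> [] \<and> successively braid_step us \<and> list_all (\<lambda>u. set u \<subseteq> {1, 2, 3}) us" for us
    using that skein_eq_path by blast
  have 1: "skein_eq (hd us) (last us)"
    if "us = [[2,1,3,2,1],[2,3,1,2,1],[2,3,2,1,2],[3,2,3,1,2],[3,2,1,3,2]]" for us
    by (rule path, unfold that, code_simp)
  show "skein_eq [2,1,3,2,1] [3,2,1,3,2]" using 1 by simp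
  have 2: "skein_eq (hd us) (last us)"
    if "us = [[3,2,1,2,3],[3,1,2,1,3],[1,3,2,1,3],[1,3,2,3,1],[1,2,3,2,1]]" for us
    by (rule path, unfold that, code_simp)
  show "skein_eq [3,2,1,2,3] [1,2,3,2,1]" using 2 by simp
  have 3: "skein_eq (hd us) (last us)"
    if "us = [[2,3,2,1,3],[3,2,3,1,3],[3,2,1,3,3]]" for us
    by (rule path, unfold that, code_simp)
  show "skein_eq [2,3,2,1,3] [3,2,1,3,3]" using 3 by simp
  have 4: "skein_eq (hd us) (last us)"
    if "us = [[1,3,2,1,2],[3,1,2,1,2],[3,2,1,2,2]]" for us
    by (rule path, unfold that, code_simp)
  show "skein_eq [1,3,2,1,2] [3,2,1,2,2]" using 4 by simp
  have 5: "skein_eq (hd us) (last us)"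
    if "us = [[2,2,3,2,1],[2,3,2,3,1],[2,3,2,1,3],[3,2,3,1,3],[3,2,1,3,3]]" for us
    by (rule path, unfold that, code_simp)
  show "skein_eq [2,2,3,2,1] [3,2,1,3,3]" using 5 by simp
  have 6: "skein_eq (hd us) (last us)"
    if "us = [[1,1,3,2,1],[1,3,1,2,1],[1,3,2,1,2],[3,1,2,1,2],[3,2,1,2,2]]" for us
    by (rule path, unfold that, code_simp)
  show "skein_eq [1,1,3,2,1] [3,2,1,2,2]" using 6 by simp
  have 7: "skein_eq (hd us) (last us)"
    if "us = [[2,1,3,3,1],[2,3,1,3,1],[2,3,1,1,3]]" for us
    by (rule path, unfold that, code_simp)
  show "skein_eq [2,1,3,3,1] [2,3,1,1,3]" using 7 by simp
  have 8: "skein_eq (hd us) (last us)"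
    if "us = [[2,1,2,2,1],[1,2,1,2,1],[1,2,2,1,2]]" for us
    by (rule path, unfold that, code_simp)
  show "skein_eq [2,1,2,2,1] [1,2,2,1,2]" using 8 by simp
  have 9: "skein_eq (hd us) (last us)"
    if "us = [[2,3,2,2,3],[3,2,3,2,3],[3,2,2,3,2]]" for us
    by (rule path, unfold that, code_simp)
  show "skein_eq [2,3,2,2,3] [3,2,2,3,2]" using 9 by simp
  have 10: "skein_eq (hd us) (last us)"
    if "us = [[3,1,1,3,2],[1,3,1,3,2],[1,3,3,1,2]]" for us
    by (rule path, unfold that, code_simp)
  show "skein_eq [3,1,1,3,2] [1,3,3,1,2]" using 10 by simp
  have 11: "skein_eq (hd us) (last us)"
    if "us = [[3,3,1,2,3],[3,1,3,2,3],[1,3,3,2,3],[1,3,2,3,2],[1,2,3,2,2]]" for us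
    by (rule path, unfold that, code_simp)
  show "skein_eq [3,3,1,2,3] [1,2,3,2,2]" using 11 by simp
  have 12: "skein_eq (hd us) (last us)"
    if "us = [[2,2,1,2,3],[2,1,2,1,3],[1,2,1,1,3],[1,2,1,3,1],[1,2,3,1,1]]" for us
    by (rule path, unfold that, code_simp)
  show "skein_eq [2,2,1,2,3] [1,2,3,1,1]" using 12 by simp
qed

section \<open>The meridian\<close>

lemma T_less_L: "b < 4 \<Longrightarrow> b' < 4 \<Longrightarrow> T b < T b' \<longleftrightarrow> L b b'"
  by (simp add: L_def)

text \<open>Ranking a branch by the number of branches that enter before it gives a permutation with
  the same order as \<open>T\<close>, so \<open>L\<close> is among the orders checked.\<close>

lemma balanced_L: "balanced L"
proof -
  define rk where "rk b = card {c. c < 4 \<and> T c < T b}" for b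
  have mono: "rk b < rk b'" if "T b < T b'" "b < 4" for b b'
    unfolding rk_def using that by (intro psubset_card_mono) (auto intro: less_trans)
  have iff: "T b < T b' \<longleftrightarrow> rk b < rk b'" if "b < 4" "b' < 4" for b b'
    using mono[of b b'] mono[of b' b] that rk_def by (cases "T b" "T b'" rule: linorder_cases) auto
  have "rk b < 4" if "b < 4" for b
  proof -
    have "rk b < card {c. c < (4::nat)}"
      unfolding rk_def using that by (intro psubset_card_mono) auto
    then show ?thesis by simp
  qed
  then have lt: "rk b \<in> {0, 1, 2, 3}" if "b < 4" for b using that by fastforce
  define r where "r = [rk 0, rk 1, rk 2, rk 3]"
  have rb: "r ! b = rk b" if "b < 4" for b
  proof -
    have "b \<in> {0, 1, 2, 3}" using that by auto
    then show ?thesis by (auto simp: r_def numeral_2_eq_2 numeral_3_eq_3)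
  qed
  have ne: "rk b \<noteq> rk b'" if "b < 4" "b' < 4" "b \<noteq> b'" for b b'
    using T_gap[OF that(1,2)] T_gap[OF that(2,1)] iff[OF that(1,2)] iff[OF that(2,1)] that(3)
    by (metis add_lessD1 less_irrefl nat_le_linear)
  have "distinct r" using ne by (simp add: r_def)
  moreover have "list_all2 (\<lambda>i js. i \<in> set js) r (replicate 4 [0, 1, 2, 3])"
    unfolding list_all2_conv_all_nth
  proof (intro conjI allI impI)
    fix i assume "i < length r"
    then have i: "i < 4" by (simp add: r_def)
    then show "r ! i \<in> set (replicate 4 [0, 1, 2, 3] ! i)" using lt[OF i] rb[OF i] by simp
  qed (simp add: r_def)
  then have "r \<in> set (List.product_lists (replicate 4 [0, 1, 2, 3]))"
    by (simp only: product_lists_set mem_Collect_eq)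
  ultimately have "r \<in> set rankings" by (simp add: rankings_def)
  then have "balanced (ranked r)" using balanced_rankings by (simp add: list_all_iff)
  moreover have "ranked r = L" using iff rb by (auto simp: ranked_def L_def fun_eq_iff)
  ultimately show ?thesis by simp
qed

section \<open>Triple crossings as words in the hole\<close>

fun entry_place :: "entry \<Rightarrow> place" where
  "entry_place (x, s, y) = (X @ braid a x, a + s, braid a y @ Y)"

text \<open>Moves from the hole of the triple crossing to that of the quadruple crossing, both for
  the perturbations and for the smoothings \<open>[2, 1]\<close>, \<open>[2, 2]\<close> and
  \<open>[1, 1]\<close>.\<close>

lemma fill_entry: "fill (entry_place e) w = dgm (word e w)"
  by (cases e) (simp add: fill.simps braid_def add.assoc)

lemma entry_facts:
  assumes "regular e w"
  defines "u \<equiv> word e w"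
  shows "half_twist u" "each_pair_once u" "branch e 0 < 4" "branch e 1 < 4" "branch e 2 < 4"
    "hm_layer e w < 6" "d_layer e < 6"
    "low u (hm_layer e w) = branch e 1" "high u (hm_layer e w) = branch e 2"
    "low u (d_layer e) = branch e 0" "high u (d_layer e) = branch e 2"
  using assms by (cases e; auto simp: regular_def Let_def)+

text \<open>All three branches have passed the layers of \<open>x\<close>, so their times are
  shifted equally and the global type depends on \<open>T\<close> alone.\<close>

lemma entry_times:
  assumes "regular e w"
  shows "low_time B (entry_place e) w = T (branch e 0) + length (fst e)"
    "mid_time B (entry_place e) w = T (branch e 1) + length (fst e)"
    "high_time B (entry_place e) w = T (branch e 2) + length (fst e)"
proof -
  obtain x s y where e: "e = (x, s, y)" by (cases e)
  note f = entry_facts[OF assms]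
  have len: "length x \<le> 6" using f(7) e by simp
  have t: "time B (fill (entry_place e) w) (length (X @ braid a x), a + s + i) = T (branch e i) + length x"
    if "branch e i < 4" for i
  proof -
    have "pt (word e w) (length x) (branch e i) = (length (X @ braid a x), a + s + i)"
      by (simp add: e pt_def)
    then show ?thesis using time_pt[OF f(1) that len] by (simp add: fill_entry)
  qed
  show "low_time B (entry_place e) w = T (branch e 0) + length (fst e)"
    "mid_time B (entry_place e) w = T (branch e 1) + length (fst e)"
    "high_time B (entry_place e) w = T (branch e 2) + length (fst e)"
    using t[OF f(3)] t[OF f(4)] t[OF f(5)] e by simp_all
qed

text \<open>For the other global types the list of keys is empty and both sides vanish.\<close>

lemma entry_x:
  assumes "regular e w"
  shows "(if type_ra B (entry_place e) w \<or> type_lc B (entry_place e) w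
      then smult (of_int (c * W1 B (entry_place e) w)) M else 0) =
    smult (of_int (c * val (x_keys L e w))) M"
proof -
  note f = entry_facts[OF assms]
  have "hm_crossing (entry_place e) w = n + hm_layer e w" by (cases e) simp
  then have "W1 B (entry_place e) w = val (keys1 L (events (word e w)) (hm_layer e w) (branch e 1) (branch e 2))"
    using val_keys1[OF f(1,6)] f(8,9) by (simp add: W1_def Let_def fill_entry)
  moreover have "type_ra B (entry_place e) w \<or> type_lc B (entry_place e) w \<longleftrightarrow>
    L (branch e 1) (branch e 2) \<and> L (branch e 2) (branch e 0) \<or> L (branch e 1) (branch e 0) \<and> L (branch e 0) (branch e 2)"
    using f(3-5) by (simp add: type_ra_def type_lc_def entry_times[OF assms] T_less_L)
  ultimately show ?thesis by (simp add: x_keys_def Let_def val_def)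
qed

lemma entry_y:
  assumes "regular e w"
  shows "(if d_type0 B (entry_place e) w then smult (of_int (c * W2 B (entry_place e) w)) M else 0) =
    smult (of_int (c * val (y_keys L e w))) M"
proof -
  note f = entry_facts[OF assms]
  have d: "d_crossing (entry_place e) = n + d_layer e" by (cases e) simp
  have t: "type1 B (dgm (word e w)) (n + d_layer e) \<longleftrightarrow> L (branch e 0) (branch e 2)"
    using f by (simp add: type1_def crossing_times T_less_L)
  show ?thesis
  proof (cases "L (branch e 0) (branch e 2)")
    case True
    then show ?thesis using t d by (simp add: d_type0_def fill_entry y_keys_def val_def)
  next
    case False
    then have "W2 B (entry_place e) w = val (keys2 L (events (word e w)) (d_layer e) (branch e 2))"
      using val_keys2[OF f(1,2,7)] t d f(11) by (simp add: W2_def Let_def fill_entry)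
    then show ?thesis using False t d by (simp add: d_type0_def fill_entry y_keys_def)
  qed
qed

lemma val_sort:
  assumes "sort xs = sort ys"
  shows "val xs = val ys"
proof -
  have "mset xs = mset ys" using arg_cong[OF assms, of mset] by simp
  then show ?thesis by (simp only: val_def sum_mset_sum_list[symmetric] mset_map)
qed

lemma val_of_sort: "val (sort xs) = val xs"
  by (rule val_sort) (simp add: sorted_sort_id)

text \<open>The formal identities are evaluated at the actual integers \<open>N\<close> and
  \<open>F\<close>.\<close>

lemma balanced_values:
  defines "x \<equiv> \<lambda>k. val (x_keys L (entries ! k) [1, 2, 1])" and "y \<equiv> \<lambda>k. val (y_keys L (entries ! k) [1, 2, 1])"
  shows "x 0 + x 1 = x 4 + x 5" "y 4 = x 2 + y 0" "x 6 = x 2" "x 7 = x 3"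
    "y 2 = y 1" "y 5 = y 1" "y 6 = y 1" "y 7 = y 3"
    "e \<in> set entries \<Longrightarrow> val (x_keys L e [2, 1, 2]) = val (x_keys L e [1, 2, 1])"
    "e \<in> set entries \<Longrightarrow> val (y_keys L e [2, 1, 2]) = val (y_keys L e [1, 2, 1])"
proof -
  let ?xs = "map (\<lambda>e. sort (x_keys L e [1, 2, 1])) entries" and ?ys = "map (\<lambda>e. sort (y_keys L e [1, 2, 1])) entries"
  have len: "length entries = 8" by (simp add: entries_def)
  have x: "val (?xs ! k) = x k" and y: "val (?ys ! k) = y k" if "k < 8" for k
    using that len by (simp_all add: x_def y_def val_of_sort)
  have b: "?xs = map (\<lambda>e. sort (x_keys L e [2, 1, 2])) entries"
    "?ys = map (\<lambda>e. sort (y_keys L e [2, 1, 2])) entries"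
    "sort (?xs ! 0 @ ?xs ! 1) = sort (?xs ! 4 @ ?xs ! 5)" "sort (?xs ! 2 @ ?ys ! 0) = ?ys ! 4"
    "?xs ! 6 = ?xs ! 2" "?xs ! 7 = ?xs ! 3"
    "?ys ! 2 = ?ys ! 1" "?ys ! 5 = ?ys ! 1" "?ys ! 6 = ?ys ! 1" "?ys ! 7 = ?ys ! 3"
    using balanced_L unfolding balanced_def Let_def
    by - (elim conjE, assumption)+
  show "x 0 + x 1 = x 4 + x 5"
    using val_sort[OF b(3)] x[of 0] x[of 1] x[of 4] x[of 5] unfolding val_append by linarith
  have "val (?xs ! 2 @ ?ys ! 0) = val (?ys ! 4)"
    unfolding b(4)[symmetric] val_of_sort by (rule refl)
  then show "y 4 = x 2 + y 0" using x[of 2] y[of 0] y[of 4] unfolding val_append by linarith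
  show "x 6 = x 2" using x[of 6] x[of 2] unfolding b(5) by linarith
  show "x 7 = x 3" using x[of 7] x[of 3] unfolding b(6) by linarith
  show "y 2 = y 1" using y[of 2] y[of 1] unfolding b(7) by linarith
  show "y 5 = y 1" using y[of 5] y[of 1] unfolding b(8) by linarith
  show "y 6 = y 1" using y[of 6] y[of 1] unfolding b(9) by linarith
  show "y 7 = y 3" using y[of 7] y[of 3] unfolding b(10) by linarith
  show "val (x_keys L e [2, 1, 2]) = val (x_keys L e [1, 2, 1])" if "e \<in> set entries"
    using b(1) that unfolding map_eq_conv by (intro val_sort) (rule sym, blast)
  show "val (y_keys L e [2, 1, 2]) = val (y_keys L e [1, 2, 1])" if "e \<in> set entries"
    using b(2) that unfolding map_eq_conv by (intro val_sort) (rule sym, blast)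
qed

section \<open>Cancellation in the meridian sum\<close>

definition meridian_signs :: "int list" where
  "meridian_signs = [1, 1, 1, 1, - 1, - 1, - 1, - 1]"

lemma meridian_entries:
  "meridian (X, a, Y) = map (\<lambda>(c, e). (c, entry_place e)) (zip meridian_signs entries)"
  by (simp add: meridian_signs_def entries_def)

lemma meridian_sum_in_span:
  defines "S \<equiv> \<lambda>u. dia (dgm u)"
  shows "(\<Sum>(c, e)\<leftarrow>zip meridian_signs entries.
       smult (of_int (c * val (x_keys L e [1, 2, 1]))) (S (word e [2, 1]))) +
     (\<Sum>(c, e)\<leftarrow>zip meridian_signs entries.
       smult (of_int (c * val (y_keys L e [1, 2, 1]))) (S (word e [2, 2]) - S (word e [1, 1])))
     \<in> kauffman.span (skein_relators (tops B) (bottoms B))" (is "?t \<in> ?V")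
proof -
  define x where "x k = val (x_keys L (entries ! k) [1, 2, 1])" for k
  define y where "y k = val (y_keys L (entries ! k) [1, 2, 1])" for k
  note b = balanced_values[folded x_def y_def]
  define f where "f c u = smult (of_int c) (S u)" for c :: int and u
  have f_add: "f (c + d) u = f c u + f d u" and f_uminus: "f (- c) u = - f c u"
    and f_diff: "f (c - d) u = f c u - f d u" for c d u
    by (simp_all add: f_def kauffman.scale_left_distrib kauffman.scale_left_diff_distrib)
  have smult_diff: "smult (of_int c) (S u - S u') = f c u - f c u'" for c u u'
    by (simp add: f_def kauffman.scale_right_diff_distrib)
  have in_V: "f c u - f c u' \<in> ?V" if "skein_eq u u'" for c u u'
    using that unfolding skein_eq_def smult_diff[symmetric] S_def by (rule kauffman.span_scale)
  have e: "entries = map ((!) entries) [0, 1, 2, 3, 4, 5, 6, 7]" by (simp add: entries_def)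
  \<comment> \<open>With \<open>\<sigma>\<^sub>2\<sigma>\<^sub>1\<close> inserted, the first two
    entries become the same word, and so do the fifth and the sixth; hence a relation between the
    sums of coefficients is enough.\<close>
  have x0: "x 0 = x 4 + x 5 - x 1" using b(1) by simp
  have t: "?t = (\<Sum>(c, k)\<leftarrow>zip meridian_signs [0, 1, 2, 3, 4, 5, 6, 7]. f (c * x k) (word (entries ! k) [2, 1])) +
    (\<Sum>(c, k)\<leftarrow>zip meridian_signs [0, 1, 2, 3, 4, 5, 6, 7].
       f (c * y k) (word (entries ! k) [2, 2]) - f (c * y k) (word (entries ! k) [1, 1]))"
    unfolding smult_diff unfolding f_def[symmetric]
    by (subst (1 2) e) (simp add: meridian_signs_def x_def y_def)
  also have "\<dots> =
     f (x 0) [2,1,3,2,1] + f (x 1) [2,1,3,2,1] + f (x 2) [2,3,2,1,3] + f (x 3) [3,2,1,2,3]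
     - f (x 4) [3,2,1,3,2] - f (x 5) [3,2,1,3,2] - f (x 6) [1,3,2,1,2] - f (x 7) [1,2,3,2,1]
     + (f (y 0) [2,2,3,2,1] - f (y 0) [1,1,3,2,1]) + (f (y 1) [2,1,3,3,1] - f (y 1) [2,1,2,2,1])
     + (f (y 2) [2,3,2,2,3] - f (y 2) [2,3,1,1,3]) + (f (y 3) [3,3,1,2,3] - f (y 3) [2,2,1,2,3])
     - (f (y 4) [3,2,1,3,3] - f (y 4) [3,2,1,2,2]) - (f (y 5) [3,2,2,3,2] - f (y 5) [3,1,1,3,2])
     - (f (y 6) [1,3,3,1,2] - f (y 6) [1,2,2,1,2]) - (f (y 7) [1,2,3,2,2] - f (y 7) [1,2,3,1,1])"
    by (simp add: meridian_signs_def entries_def f_uminus numeral_2_eq_2 numeral_3_eq_3 algebra_simps)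
  \<comment> \<open>The coefficients are reduced to \<open>x 2\<close>, \<open>x 3\<close>,
    \<open>x 4\<close>, \<open>x 5\<close>, \<open>y 0\<close>, \<open>y 1\<close>,
    \<open>y 3\<close>, and the terms are grouped into differences of equivalent words in the order
    of \<open>skein_eq_words\<close>.\<close>
  also have "\<dots> =
     (f (x 4) [2,1,3,2,1] - f (x 4) [3,2,1,3,2]) + (f (x 5) [2,1,3,2,1] - f (x 5) [3,2,1,3,2]) +
     (f (x 3) [3,2,1,2,3] - f (x 3) [1,2,3,2,1]) +
     (f (x 2) [2,3,2,1,3] - f (x 2) [3,2,1,3,3]) - (f (x 2) [1,3,2,1,2] - f (x 2) [3,2,1,2,2]) +
     (f (y 0) [2,2,3,2,1] - f (y 0) [3,2,1,3,3]) - (f (y 0) [1,1,3,2,1] - f (y 0) [3,2,1,2,2]) +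
     (f (y 1) [2,1,3,3,1] - f (y 1) [2,3,1,1,3]) - (f (y 1) [2,1,2,2,1] - f (y 1) [1,2,2,1,2]) +
     (f (y 1) [2,3,2,2,3] - f (y 1) [3,2,2,3,2]) + (f (y 1) [3,1,1,3,2] - f (y 1) [1,3,3,1,2]) +
     (f (y 3) [3,3,1,2,3] - f (y 3) [1,2,3,2,2]) - (f (y 3) [2,2,1,2,3] - f (y 3) [1,2,3,1,1])"
    unfolding x0 b(2-8) f_add f_diff by (simp only: algebra_simps)
  also have "\<dots> \<in> ?V"
    by (intro kauffman.span_add kauffman.span_diff in_V skein_eq_words)
  finally show ?thesis .
qed

text \<open>The perturbation may vary with the place. Equality of the weights for both perturbations
  reduces everything to \<open>[1, 2, 1]\<close>, where the sum lies in the span of the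
  relators.\<close>

lemma R_F_zero:
  assumes pert: "\<And>p. pert p \<in> {[1, 2, 1], [2, 1, 2]}"
  shows "R_F B pert (X, a, Y) = skein_class (tops B) (bottoms B) 0"
proof -
  let ?V = "kauffman.span (skein_relators (tops B) (bottoms B))"
  let ?p = entry_place
  have reg: "regular e (pert (?p e))" if "e \<in> set entries" for e
    using regular_entries pert[of "?p e"] that by (auto simp: list_all_iff)
  have X: "(if type_ra B (?p e) (pert (?p e)) \<or> type_lc B (?p e) (pert (?p e))
         then smult (of_int (c * W1 B (?p e) (pert (?p e)))) (dia (fill (?p e) [2, 1])) else 0) =
      smult (of_int (c * val (x_keys L e [1, 2, 1]))) (dia (dgm (word e [2, 1])))"
    if "(c, e) \<in> set (zip meridian_signs entries)" for c e
  proof -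
    have e: "e \<in> set entries" using that by (rule set_zip_rightD)
    have "val (x_keys L e (pert (?p e))) = val (x_keys L e [1, 2, 1])"
      using pert[of "?p e"] balanced_values(9)[OF e] by (elim insertE) simp_all
    then show ?thesis unfolding entry_x[OF reg[OF e]] fill_entry by simp
  qed
  have Y: "(if d_type0 B (?p e) (pert (?p e))
         then smult (of_int (c * W2 B (?p e) (pert (?p e))))
           (dia (fill (?p e) [2, 2]) - dia (fill (?p e) [1, 1])) else 0) =
      smult (of_int (c * val (y_keys L e [1, 2, 1]))) (dia (dgm (word e [2, 2])) - dia (dgm (word e [1, 1])))"
    if "(c, e) \<in> set (zip meridian_signs entries)" for c e
  proof -
    have e: "e \<in> set entries" using that by (rule set_zip_rightD)
    have "val (y_keys L e (pert (?p e))) = val (y_keys L e [1, 2, 1])"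
      using pert[of "?p e"] balanced_values(10)[OF e] by (elim insertE) simp_all
    then show ?thesis unfolding entry_y[OF reg[OF e]] fill_entry by simp
  qed
  obtain t where t: "R_F B pert (X, a, Y) = skein_class (tops B) (bottoms B) t" "t \<in> ?V"
  proof
    show "R_F B pert (X, a, Y) = skein_class (tops B) (bottoms B) ((\<Sum>(c, e)\<leftarrow>zip meridian_signs entries.
       smult (of_int (c * val (x_keys L e [1, 2, 1]))) (dia (dgm (word e [2, 1])))) +
     (\<Sum>(c, e)\<leftarrow>zip meridian_signs entries.
       smult (of_int (c * val (y_keys L e [1, 2, 1]))) (dia (dgm (word e [2, 2])) - dia (dgm (word e [1, 1])))))"
      unfolding R_F_def meridian_entries map_map
      by (intro arg_cong[of _ _ "skein_class (tops B) (bottoms B)"] arg_cong2[of _ _ _ _ "(+)"]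
          arg_cong[of _ _ sum_list] map_cong refl)
        (simp_all only: o_def split_def fst_conv snd_conv X Y prod.collapse)
  qed (rule meridian_sum_in_span)
  have "y - t \<in> ?V \<longleftrightarrow> y \<in> ?V" for y
    using kauffman.span_add[OF _ t(2), of "y - t"] kauffman.span_diff[OF _ t(2), of y] by auto
  then show ?thesis unfolding t(1) skein_class_def by simp
qed

end

theorem proposition9:
  fixes B :: closed_boundary and Q :: place and pert :: "place \<Rightarrow> nat list"
  assumes "positive_quadruple B Q"
    and "\<And>p. pert p \<in> {[1, 2, 1], [2, 1, 2]}"
  shows "R_F B pert Q = skein_class (tops B) (bottoms B) 0"
proof -
  obtain X a Y where Q: "Q = (X, a, Y)" by (cases Q)
  interpret quadruple B X a Y using assms(1) Q by unfold_locales simp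
  show ?thesis unfolding Q by (rule R_F_zero[OF assms(2)])
qed

end
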